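(* Let $E_J$ be a $W$-graph ideal for the weighted Coxeter system $(W,S,L)$, let $x,y\in E_J$ and $\gamma\in\Gamma''$. Then $$[q^\gamma](Q_{x,y})=[q^\gamma](\epsilon_x\epsilon_yR_{x,y})+\sum_{r=1}^{\ell(y)-\ell(x)}\ \sum_{\varphi\in\mathscr{M}_r(x,y)}\ \sum_{(\lambda_0,\ldots,\lambda_{r+1})\in\mathscr{F}^*_\gamma(\varphi)}\ \prod_{i=0}^{r}\big[q_xq_{x_{r-i}}^{-1}q^{\lambda_i}q^{\lambda_{i+1}}\big](\widetilde R_{x_{r-i},x_{r+1-i}}),$$ where $\varphi$ denotes the multichain $x=x_0\leqslant x_1\leqslant\cdots\leqslant x_{r+1}=y$.
   Context: Setting. $(W,S)$ is a Coxeter system with length function $\ell$ and Bruhat order $\leqslant$; $\epsilon_w=(-1)^{\ell(w)}$. $\Gamma$ is a totally ordered abelian group (written additively). $\mathbb{Z}[\Gamma]$ is its group ring with $\mathbb{Z}$-basis $\{q^\gamma\mid\gamma\in\Gamma\}$, $q^\gamma q^\zeta=q^{\gamma+\zeta}$; $[q^\gamma](f)$ is the coefficient of $q^\gamma$ in $f$; $\mathsf{deg}(f)$ is the largest $\gamma$ with $[q^\gamma](f)\neq0$, $\mathsf{deg}(0)=-\infty$. The bar is the ring automorphism $q^\gamma\mapsto q^{-\gamma}$. $L:W\to\Gamma$ is a weight: $L(w)=L(s_1)+\cdots+L(s_k)$ for every reduced word $w=s_1\cdots s_k$, and $L(s)\geqslant0$ for all $s\in S$. Put $q_w=q^{L(w)}$;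 thus e.g. $[q_xq_z^{-1}q^{\lambda}q^{\mu}]$ means the coefficient of $q^{L(x)-L(z)+\lambda+\mu}$. $\Gamma''=\{\sum n_iL(s_i)\mid s_i\in S,n_i\in\mathbb{Z}\}$ (finite sums). $\mathscr{H}$ is the Hecke algebra over $\mathbb{Z}[\Gamma]$ with basis $\{T_w\}_{w\in W}$, $T_sT_w=T_{sw}$ if $\ell(sw)>\ell(w)$, $T_sT_w=q_sT_{sw}+(q_s-1)T_w$ if $\ell(sw)<\ell(w)$, with bar involution (semilinear ring involution) $\overline{T_s}=q_s^{-1}T_s+(q_s^{-1}-1)$. $W$-graph ideal. $x$ is a suffix of $y$ ($x\leqslant_L y$) if $y=zx$ with $\ell(y)=\ell(z)+\ell(x)$. Let $E\subseteq W$ be an ideal of $(W,\leqslant_L)$, i.e. every suffix of an element of $E$ is in $E$. For $J\subseteq S$, $D_J=\{w\mid\ell(ws)>\ell(w)\ \forall s\in J\}$. Let $J\subseteq\{s\in S\mid\ell(xs)>\ell(x)\ \forall x\in E\}$, so $E\subseteq D_J$; write $E_J$ for $E$ with this $J$. For $y\in E_J$: $SD(y)=\{s\mid\ell(sy)<\ell(y)\}$, $SA(y)=\{s\mid\ell(sy)>\ell(y),sy\in E_J\}$, $WD(y)=\{s\mid\ell(sy)>\ell(y),sy\notin D_J\}$, $WA(y)=\{s\mid\ell(sy)>\ell(y),sy\in D_J\setminus E_J\}$. $E_J$ is a $W$-graph ideal if there is an $\mathscr{H}$-module $M(E_J,L)$, free over $\mathbb{Z}[\Gamma]$ with basis $\{\Gamma_y\mid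 y\in E_J\}$, such that $T_s\Gamma_y$ equals $q_s\Gamma_{sy}+(q_s-1)\Gamma_y$ if $s\in SD(y)$; $\Gamma_{sy}$ if $s\in SA(y)$; $-\Gamma_y$ if $s\in WD(y)$; $q_s\Gamma_y-\sum_{z<sy,\,z\in E_J}r^s_{z,y}\Gamma_z$ if $s\in WA(y)$, for some $r^s_{z,y}\in q_s\mathbb{Z}[\Gamma]$; and $M(E_J,L)$ admits a $\mathbb{Z}[\Gamma]$-semilinear involution $m\mapsto\overline m$ with $\overline{\Gamma_1}=\Gamma_1$ and $\overline{T_w\Gamma_y}=\overline{T_w}\,\overline{\Gamma_y}$ for all $w\in W,y\in E_J$. Fix such a module. $R$-polynomials. $R_{x,y}\in\mathbb{Z}[\Gamma]$ ($x,y\in E_J$) are defined by $\overline{\Gamma_y}=\sum_{x\in E_J}\epsilon_x\epsilon_yq_y^{-1}R_{x,y}\Gamma_x$. Standing facts: $R_{x,y}=0$ if $x\not\leqslant y$, $R_{x,x}=1$, and for $x\leqslant y$ all exponents $\gamma$ occurring in $R_{x,y}$ lie in $\Gamma''$ and satisfy $0\leqslant\gamma\leqslant L(y)-L(x)$. The dual $R$-polynomials $\widetilde R_{x,y}$ are determined by $\overline{R_{x,y}}=\epsilon_x\epsilon_yq_xq_y^{-1}\widetilde R_{x,y}$. Kazhdan–Lusztig polynomials. $P_{x,y}\in\mathbb{Z}[\Gamma]$ ($x,y\in E_J$) is the unique family with $P_{x,y}=0$ if $x\not\leqslant y$, $P_{x,x}=1$, $\mathsf{deg}(P_{x,y})<\frac{L(y)-L(x)}2$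 for $x<y$ (i.e. $2\,\mathsf{deg}(P_{x,y})<L(y)-L(x)$), and $q_x^{-1}q_y\overline{P_{x,y}}=\sum_{x\leqslant t\leqslant y,\,t\in E_J}R_{x,t}P_{t,y}$. The inverse weighted Kazhdan–Lusztig polynomials $Q_{x,y}$ ($x,y\in E_J$) are given recursively by $Q_{x,y}=0$ if $x\not\leqslant y$ and $\sum_{x\leqslant t\leqslant y,\,t\in E_J}\epsilon_t\epsilon_yQ_{x,t}P_{t,y}=\delta_{x,y}$. Multichains. $\mathscr{M}_r(x,y)$ is the set of multichains $x=x_0\leqslant x_1\leqslant\cdots\leqslant x_{r+1}=y$ with all $x_i\in E_J$ (Bruhat order). Index sets. For $\varphi\in\mathscr{M}_r(x,y)$, $\mathscr{F}^*_\gamma(\varphi)$ is the set of $(a_0,a_1,\ldots,a_{r+1})\in(\Gamma'')^{r+2}$ such that $a_0=L(y)-L(x)-\gamma$; $\gamma\geqslant a_1>a_2>\cdots>a_r>a_{r+1}=0$; and $a_i>L(x_{r+1-i})-L(x)-a_i\geqslant a_{i+1}$ for $i\in\{1,\ldots,r\}$. *)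

theory Defs
  imports
    "HOL.Modules"
    "HOL-Library.Poly_Mapping"
    "HOL-Computational_Algebra.Group_Closure"
    "HOL-Algebra.Generated_Groups"
begin

section \<open>The group ring \<open>\<int>[\<Gamma>]\<close>\<close>

text \<open>
  For a totally ordered abelian group \<^typ>\<open>'g::linordered_ab_group_add\<close>, the group ring
  \<open>\<int>[\<Gamma>]\<close> is the convolution ring \<open>'g \<Rightarrow>\<^sub>0 int\<close> of
  finitely supported functions; the coefficient of \<open>q\<^sup>\<gamma>\<close> in \<open>f\<close> is
  \<open>lookup f \<gamma>\<close>.
\<close>

type_synonym 'g zgr = "'g \<Rightarrow>\<^sub>0 int"

definition q :: "'g \<Rightarrow> 'g zgr"
  where "q \<gamma> = Poly_Mapping.single \<gamma> 1"

definition qbar :: "'g::linordered_ab_group_add zgr \<Rightarrow> 'g zgr"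
  where "qbar f = Poly_Mapping.map_key uminus f"

text \<open>Only meaningful for \<open>f \<noteq> 0\<close>; the convention \<open>deg 0 = -\<infinity>\<close> is spelled out at its use.\<close>

definition deg :: "'g::linordered_ab_group_add zgr \<Rightarrow> 'g"
  where "deg f = Max (Poly_Mapping.keys f)"

lemma lookup_qbar: "Poly_Mapping.lookup (qbar f) \<gamma> = Poly_Mapping.lookup f (- \<gamma>)"
  unfolding qbar_def by (simp add: map_key.rep_eq)

lemma qbar_q: "qbar (q \<gamma>) = q (- \<gamma>)"
  by (rule poly_mapping_eqI) (auto simp: lookup_qbar q_def lookup_single when_def)

lemma qbar_add: "qbar (f + g) = qbar f + qbar g"
  by (rule poly_mapping_eqI) (simp add: lookup_qbar lookup_add)

lemma lookup_single_times:
  fixes g :: "'g::linordered_ab_group_add zgr"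
  shows "Poly_Mapping.lookup (Poly_Mapping.single k c * g) l = c * Poly_Mapping.lookup g (l - k)"
proof -
  have eq: "(l = k + b) = (b = l - k)" for b
    by (auto simp: algebra_simps)
  have *: "(\<Sum>b. Poly_Mapping.lookup g b when l = k + b) = Poly_Mapping.lookup g (l - k)"
    unfolding eq by simp
  have "Poly_Mapping.lookup (Poly_Mapping.single k c * g) l
      = (\<Sum>a. (c * (\<Sum>b. Poly_Mapping.lookup g b when l = a + b)) when a = k)"
    unfolding lookup_mult
    by (intro Sum_any.cong) (auto simp: lookup_single when_def)
  also have "\<dots> = c * Poly_Mapping.lookup g (l - k)"
    using * by simp
  finally show ?thesis .
qed

lemma qbar_mult:
  fixes f g :: "'a::linordered_ab_group_add zgr"
  shows "qbar (f * g) = qbar f * qbar g"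
proof -
  have single: "qbar (Poly_Mapping.single k c * g) = qbar (Poly_Mapping.single k c) * qbar g" for k c
  proof -
    have s: "qbar (Poly_Mapping.single k c) = Poly_Mapping.single (- k) c"
      by (rule poly_mapping_eqI) (auto simp: lookup_qbar lookup_single when_def)
    show ?thesis
      unfolding s
      by (rule poly_mapping_eqI) (simp add: lookup_qbar lookup_single_times)
  qed
  show ?thesis
  proof (induction f rule: update_induct)
    case const
    have "qbar (0 :: 'a zgr) = 0"
      by (rule poly_mapping_eqI) (simp add: lookup_qbar)
    then show ?case by simp
  next
    case (update f a b)
    have "Poly_Mapping.update a b f = f + Poly_Mapping.single a b"
      using update(1)
      by (intro poly_mapping_eqI)
        (auto simp: lookup_update lookup_add lookup_single when_def in_keys_iff)
    then show ?case
      using update by (simp add: distrib_right qbar_add single)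
  qed
qed


section \<open>Coxeter systems\<close>

definition word_prod :: "('w, 'k) monoid_scheme \<Rightarrow> 'w list \<Rightarrow> 'w"
  where "word_prod W ws = foldr (\<otimes>\<^bsub>W\<^esub>) ws \<one>\<^bsub>W\<^esub>"

text \<open>Coxeter matrices; the entry \<open>\<infinity>\<close> is encoded as \<open>0\<close>.\<close>

definition coxeter_matrix :: "'w set \<Rightarrow> ('w \<Rightarrow> 'w \<Rightarrow> nat) \<Rightarrow> bool"
  where "coxeter_matrix S m \<longleftrightarrow>
    (\<forall>s\<in>S. m s s = 1) \<and> (\<forall>s\<in>S. \<forall>t\<in>S. m s t = m t s) \<and> (\<forall>s\<in>S. \<forall>t\<in>S. s \<noteq> t \<longrightarrow> m s t \<noteq> 1)"

text \<open>
  The congruence on words over \<open>S\<close> generated by the Coxeter relations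
  \<open>(st)\<^bsup>m s t\<^esup> = 1\<close>; as \<open>m s s = 1\<close>, it contains \<open>ss = 1\<close>, so that the quotient of the
  free monoid by it is the group presented by these relations.  Infinite entries, encoded as
  \<open>0\<close>, yield the trivial relation.
\<close>

inductive coxeter_cong :: "'w set \<Rightarrow> ('w \<Rightarrow> 'w \<Rightarrow> nat) \<Rightarrow> 'w list \<Rightarrow> 'w list \<Rightarrow> bool"
  for S m
where
  refl: "u \<in> lists S \<Longrightarrow> coxeter_cong S m u u"
| sym: "coxeter_cong S m u v \<Longrightarrow> coxeter_cong S m v u"
| trans: "coxeter_cong S m u v \<Longrightarrow> coxeter_cong S m v w \<Longrightarrow> coxeter_cong S m u w"
| rel: "u \<in> lists S \<Longrightarrow> v \<in> lists S \<Longrightarrow> s \<in> S \<Longrightarrow> t \<in> S \<Longrightarrow>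
    coxeter_cong S m (u @ concat (replicate (m s t) [s, t]) @ v) (u @ v)"

locale coxeter_system = group W
  for W :: "('w, 'k) monoid_scheme" (structure) +
  fixes S :: "'w set"
  assumes S_subset: "S \<subseteq> carrier W"
    and S_generates: "generate W S = carrier W"
    and presentation: "\<exists>m. coxeter_matrix S m \<and>
      (\<forall>u\<in>lists S. \<forall>v\<in>lists S. word_prod W u = word_prod W v \<longleftrightarrow> coxeter_cong S m u v)"

definition cox_length :: "('w, 'k) monoid_scheme \<Rightarrow> 'w set \<Rightarrow> 'w \<Rightarrow> nat"
  where "cox_length W S w = (LEAST n. \<exists>ws\<in>lists S. word_prod W ws = w \<and> length ws = n)"

definition reduced_word :: "('w, 'k) monoid_scheme \<Rightarrow> 'w set \<Rightarrow> 'w list \<Rightarrow> bool"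
  where "reduced_word W S ws \<longleftrightarrow> ws \<in> lists S \<and> length ws = cox_length W S (word_prod W ws)"

definition reflections :: "('w, 'k) monoid_scheme \<Rightarrow> 'w set \<Rightarrow> 'w set"
  where "reflections W S = {w \<otimes>\<^bsub>W\<^esub> s \<otimes>\<^bsub>W\<^esub> inv\<^bsub>W\<^esub> w | w s. w \<in> carrier W \<and> s \<in> S}"

definition bruhat_step :: "('w, 'k) monoid_scheme \<Rightarrow> 'w set \<Rightarrow> 'w \<Rightarrow> 'w \<Rightarrow> bool"
  where "bruhat_step W S u v \<longleftrightarrow> u \<in> carrier W \<and>
    (\<exists>t\<in>reflections W S. v = u \<otimes>\<^bsub>W\<^esub> t) \<and> cox_length W S u < cox_length W S v"

definition bruhat_le :: "('w, 'k) monoid_scheme \<Rightarrow> 'w set \<Rightarrow> 'w \<Rightarrow> 'w \<Rightarrow> bool"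
  where "bruhat_le W S = (bruhat_step W S)\<^sup>*\<^sup>*"

definition bruhat_less :: "('w, 'k) monoid_scheme \<Rightarrow> 'w set \<Rightarrow> 'w \<Rightarrow> 'w \<Rightarrow> bool"
  where "bruhat_less W S u v \<longleftrightarrow> bruhat_le W S u v \<and> u \<noteq> v"

definition eps :: "('w, 'k) monoid_scheme \<Rightarrow> 'w set \<Rightarrow> 'w \<Rightarrow> 'r::comm_ring_1"
  where "eps W S w = (- 1) ^ cox_length W S w"

locale weighted_coxeter_system = coxeter_system W S
  for W :: "('w, 'k) monoid_scheme" (structure) and S +
  fixes L :: "'w \<Rightarrow> 'g::linordered_ab_group_add"
  assumes weight_reduced: "reduced_word W S ws \<Longrightarrow> L (word_prod W ws) = sum_list (map L ws)"
    and weight_nonneg: "s \<in> S \<Longrightarrow> 0 \<le> L s"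

text \<open>The subgroup \<open>\<Gamma>''\<close> of \<open>\<Gamma>\<close> generated by the weights of the simple reflections.\<close>

definition weight_group :: "'w set \<Rightarrow> ('w \<Rightarrow> 'g::linordered_ab_group_add) \<Rightarrow> 'g set"
  where "weight_group S L = group_closure (L ` S)"


section \<open>Hecke algebras\<close>

text \<open>
  The Hecke algebra over \<open>\<int>[\<Gamma>]\<close>, given as a unital ring of type \<^typ>\<open>'h::ring_1\<close> with scalar
  multiplication \<open>hscale\<close>, basis \<open>(T w)\<^sub>w\<close> and bar involution \<open>hbar\<close>.
\<close>

locale hecke_algebra =
  weighted_coxeter_system W S L + H: module hscale
  for W :: "('w, 'k) monoid_scheme" (structure)
    and S and L :: "'w \<Rightarrow> 'g::linordered_ab_group_add"
    and hscale :: "'g zgr \<Rightarrow> 'h::ring_1 \<Rightarrow> 'h" +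
  fixes T :: "'w \<Rightarrow> 'h" and hbar :: "'h \<Rightarrow> 'h"
  assumes hscale_mult_left: "hscale c a * b = hscale c (a * b)"
    and hscale_mult_right: "a * hscale c b = hscale c (a * b)"
    and T_inj: "inj_on T (carrier W)"
    and T_independent: "H.independent (T ` carrier W)"
    and T_span: "H.span (T ` carrier W) = UNIV"
    and T_one: "T \<one> = 1"
    and T_mult_up: "s \<in> S \<Longrightarrow> w \<in> carrier W \<Longrightarrow> cox_length W S (s \<otimes> w) > cox_length W S w \<Longrightarrow>
      T s * T w = T (s \<otimes> w)"
    and T_mult_down: "s \<in> S \<Longrightarrow> w \<in> carrier W \<Longrightarrow> cox_length W S (s \<otimes> w) < cox_length W S w \<Longrightarrow>
      T s * T w = hscale (q (L s)) (T (s \<otimes> w)) + hscale (q (L s) - 1) (T w)"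
    and hbar_add: "hbar (a + b) = hbar a + hbar b"
    and hbar_mult: "hbar (a * b) = hbar a * hbar b"
    and hbar_one: "hbar 1 = 1"
    and hbar_scale: "hbar (hscale c a) = hscale (qbar c) (hbar a)"
    and hbar_involution: "hbar (hbar a) = a"
    and hbar_T: "s \<in> S \<Longrightarrow>
      hbar (T s) = hscale (q (- L s)) (T s) + hscale (q (- L s) - 1) 1"


section \<open>\<open>W\<close>-graph ideals\<close>

definition suffix_le :: "('w, 'k) monoid_scheme \<Rightarrow> 'w set \<Rightarrow> 'w \<Rightarrow> 'w \<Rightarrow> bool"
  where "suffix_le W S x y \<longleftrightarrow>
    (\<exists>z\<in>carrier W. y = z \<otimes>\<^bsub>W\<^esub> x \<and> cox_length W S y = cox_length W S z + cox_length W S x)"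

definition D_set :: "('w, 'k) monoid_scheme \<Rightarrow> 'w set \<Rightarrow> 'w set \<Rightarrow> 'w set"
  where "D_set W S J = {w\<in>carrier W. \<forall>s\<in>J. cox_length W S (w \<otimes>\<^bsub>W\<^esub> s) > cox_length W S w}"

definition SD :: "('w, 'k) monoid_scheme \<Rightarrow> 'w set \<Rightarrow> 'w \<Rightarrow> 'w set"
  where "SD W S y = {s\<in>S. cox_length W S (s \<otimes>\<^bsub>W\<^esub> y) < cox_length W S y}"

definition SA :: "('w, 'k) monoid_scheme \<Rightarrow> 'w set \<Rightarrow> 'w set \<Rightarrow> 'w \<Rightarrow> 'w set"
  where "SA W S E y = {s\<in>S. cox_length W S (s \<otimes>\<^bsub>W\<^esub> y) > cox_length W S y \<and> s \<otimes>\<^bsub>W\<^esub> y \<in> E}"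

definition WD :: "('w, 'k) monoid_scheme \<Rightarrow> 'w set \<Rightarrow> 'w set \<Rightarrow> 'w \<Rightarrow> 'w set"
  where "WD W S J y =
    {s\<in>S. cox_length W S (s \<otimes>\<^bsub>W\<^esub> y) > cox_length W S y \<and> s \<otimes>\<^bsub>W\<^esub> y \<notin> D_set W S J}"

definition WA :: "('w, 'k) monoid_scheme \<Rightarrow> 'w set \<Rightarrow> 'w set \<Rightarrow> 'w set \<Rightarrow> 'w \<Rightarrow> 'w set"
  where "WA W S E J y =
    {s\<in>S. cox_length W S (s \<otimes>\<^bsub>W\<^esub> y) > cox_length W S y \<and> s \<otimes>\<^bsub>W\<^esub> y \<in> D_set W S J - E}"

text \<open>
  A \<open>W\<close>-graph ideal \<open>E\<^sub>J\<close> together with a fixed witnessing module \<open>M(E\<^sub>J, L)\<close>: the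
  \<open>\<int>[\<Gamma>]\<close>-module of type \<^typ>\<open>'m::ab_group_add\<close> with scalar multiplication \<open>mscale\<close>, action
  \<open>act\<close> of the Hecke algebra, basis \<open>(B y)\<^sub>y\<close> (written \<open>\<Gamma>\<^sub>y\<close> in the literature) indexed by
  \<open>E\<close>, and bar involution \<open>mbar\<close>.
\<close>

locale w_graph_ideal =
  hecke_algebra W S L hscale T hbar + M: module mscale
  for W :: "('w, 'k) monoid_scheme" (structure)
    and S and L :: "'w \<Rightarrow> 'g::linordered_ab_group_add"
    and hscale :: "'g zgr \<Rightarrow> 'h::ring_1 \<Rightarrow> 'h"
    and T hbar
    and mscale :: "'g zgr \<Rightarrow> 'm::ab_group_add \<Rightarrow> 'm" +
  fixes E J :: "'w set"
    and act :: "'h \<Rightarrow> 'm \<Rightarrow> 'm" and B :: "'w \<Rightarrow> 'm" and mbar :: "'m \<Rightarrow> 'm"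
  assumes E_subset: "E \<subseteq> carrier W"
    and E_ideal: "y \<in> E \<Longrightarrow> x \<in> carrier W \<Longrightarrow> suffix_le W S x y \<Longrightarrow> x \<in> E"
    and J_subset: "J \<subseteq> {s\<in>S. \<forall>x\<in>E. cox_length W S (x \<otimes> s) > cox_length W S x}"
    and act_add_left: "act (a + b) m = act a m + act b m"
    and act_add_right: "act a (m + n) = act a m + act a n"
    and act_mult: "act (a * b) m = act a (act b m)"
    and act_one: "act 1 m = m"
    and act_scale_left: "act (hscale c a) m = mscale c (act a m)"
    and act_scale_right: "act a (mscale c m) = mscale c (act a m)"
    and B_inj: "inj_on B E"
    and B_independent: "M.independent (B ` E)"
    and B_span: "M.span (B ` E) = UNIV"
    and act_SD: "y \<in> E \<Longrightarrow> s \<in> SD W S y \<Longrightarrow>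
      act (T s) (B y) = mscale (q (L s)) (B (s \<otimes> y)) + mscale (q (L s) - 1) (B y)"
    and act_SA: "y \<in> E \<Longrightarrow> s \<in> SA W S E y \<Longrightarrow> act (T s) (B y) = B (s \<otimes> y)"
    and act_WD: "y \<in> E \<Longrightarrow> s \<in> WD W S J y \<Longrightarrow> act (T s) (B y) = - B y"
    and act_WA: "y \<in> E \<Longrightarrow> s \<in> WA W S E J y \<Longrightarrow>
      \<exists>r :: 'w \<Rightarrow> 'g zgr. range r \<subseteq> range ((*) (q (L s))) \<and>
        act (T s) (B y) =
          mscale (q (L s)) (B y) - (\<Sum>z | z \<in> E \<and> bruhat_less W S z (s \<otimes> y). mscale (r z) (B z))"
    and mbar_add: "mbar (m + n) = mbar m + mbar n"
    and mbar_scale: "mbar (mscale c m) = mscale (qbar c) (mbar m)"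
    and mbar_involution: "mbar (mbar m) = m"
    and mbar_one: "mbar (B \<one>) = B \<one>"
    and mbar_act: "w \<in> carrier W \<Longrightarrow> y \<in> E \<Longrightarrow>
      mbar (act (T w) (B y)) = act (hbar (T w)) (mbar (B y))"


section \<open>\<open>R\<close>-polynomials and weighted Kazhdan--Lusztig polynomials\<close>

text \<open>
  The families below are indexed by pairs of elements of \<open>E\<close> and each is uniquely determined on
  \<open>E \<times> E\<close> by its defining property; values outside \<open>E \<times> E\<close> are irrelevant.  In
  \<open>is_R_family\<close> the sum over the possibly infinite set \<open>E\<close> is a finite sum because
  \<open>mbar (B y)\<close> has finitely many nonzero coordinates.
\<close>

definition is_R_family ::
  "('w, 'k) monoid_scheme \<Rightarrow> 'w set \<Rightarrow> ('w \<Rightarrow> 'g::linordered_ab_group_add) \<Rightarrow>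
    ('g zgr \<Rightarrow> 'm::ab_group_add \<Rightarrow> 'm) \<Rightarrow> 'w set \<Rightarrow> ('w \<Rightarrow> 'm) \<Rightarrow> ('m \<Rightarrow> 'm) \<Rightarrow>
    ('w \<Rightarrow> 'w \<Rightarrow> 'g zgr) \<Rightarrow> bool"
  where "is_R_family W S L mscale E B mbar R \<longleftrightarrow>
    (\<forall>y\<in>E. finite {x\<in>E. R x y \<noteq> 0} \<and>
      mbar (B y) = (\<Sum>x | x \<in> E \<and> R x y \<noteq> 0.
        mscale (eps W S x * eps W S y * q (- L y) * R x y) (B x)))"

definition is_dual_R_family ::
  "('w, 'k) monoid_scheme \<Rightarrow> 'w set \<Rightarrow> ('w \<Rightarrow> 'g::linordered_ab_group_add) \<Rightarrow> 'w set \<Rightarrow>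
    ('w \<Rightarrow> 'w \<Rightarrow> 'g zgr) \<Rightarrow> ('w \<Rightarrow> 'w \<Rightarrow> 'g zgr) \<Rightarrow> bool"
  where "is_dual_R_family W S L E R R' \<longleftrightarrow>
    (\<forall>x\<in>E. \<forall>y\<in>E. qbar (R x y) = eps W S x * eps W S y * q (L x) * q (- L y) * R' x y)"

definition is_KL_family ::
  "('w, 'k) monoid_scheme \<Rightarrow> 'w set \<Rightarrow> ('w \<Rightarrow> 'g::linordered_ab_group_add) \<Rightarrow> 'w set \<Rightarrow>
    ('w \<Rightarrow> 'w \<Rightarrow> 'g zgr) \<Rightarrow> ('w \<Rightarrow> 'w \<Rightarrow> 'g zgr) \<Rightarrow> bool"
  where "is_KL_family W S L E R P \<longleftrightarrow>
    (\<forall>x\<in>E. \<forall>y\<in>E.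
      (\<not> bruhat_le W S x y \<longrightarrow> P x y = 0) \<and>
      (x = y \<longrightarrow> P x y = 1) \<and>
      (bruhat_less W S x y \<longrightarrow> P x y = 0 \<or> deg (P x y) + deg (P x y) < L y - L x) \<and>
      q (- L x) * q (L y) * qbar (P x y) =
        (\<Sum>t | t \<in> E \<and> bruhat_le W S x t \<and> bruhat_le W S t y. R x t * P t y))"

definition is_inverse_KL_family ::
  "('w, 'k) monoid_scheme \<Rightarrow> 'w set \<Rightarrow> 'w set \<Rightarrow>
    ('w \<Rightarrow> 'w \<Rightarrow> 'g::linordered_ab_group_add zgr) \<Rightarrow> ('w \<Rightarrow> 'w \<Rightarrow> 'g zgr) \<Rightarrow> bool"
  where "is_inverse_KL_family W S E P Q \<longleftrightarrow>
    (\<forall>x\<in>E. \<forall>y\<in>E.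
      (\<not> bruhat_le W S x y \<longrightarrow> Q x y = 0) \<and>
      (\<Sum>t | t \<in> E \<and> bruhat_le W S x t \<and> bruhat_le W S t y.
        eps W S t * eps W S y * Q x t * P t y) = (if x = y then 1 else 0))"

text \<open>
  A condition on the \<open>R\<close>-polynomials that does not follow from \<open>w_graph_ideal\<close>: since
  \<open>q (L s)\<close> is a unit of \<open>\<int>[\<Gamma>]\<close>, the coefficients \<open>r z\<close> in \<open>act_WA\<close> are not
  confined to \<open>\<int>[\<Gamma>'']\<close> or to bounded degree.
\<close>

definition R_exponents_bounded ::
  "('w, 'k) monoid_scheme \<Rightarrow> 'w set \<Rightarrow> ('w \<Rightarrow> 'g::linordered_ab_group_add) \<Rightarrow> 'w set \<Rightarrow>
    ('w \<Rightarrow> 'w \<Rightarrow> 'g zgr) \<Rightarrow> bool"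
  where "R_exponents_bounded W S L E R \<longleftrightarrow>
    (\<forall>x\<in>E. \<forall>y\<in>E. bruhat_le W S x y \<longrightarrow>
      (\<forall>\<gamma>\<in>Poly_Mapping.keys (R x y). \<gamma> \<in> weight_group S L \<and> 0 \<le> \<gamma> \<and> \<gamma> \<le> L y - L x))"


section \<open>Multichains and index sets\<close>

text \<open>The sequences \<open>(x\<^sub>0, \<dots>, x\<^bsub>r+1\<^esub>)\<close> and \<open>(a\<^sub>0, \<dots>, a\<^bsub>r+1\<^esub>)\<close> are lists of length \<open>r + 2\<close>.\<close>

definition multichains ::
  "('w, 'k) monoid_scheme \<Rightarrow> 'w set \<Rightarrow> 'w set \<Rightarrow> nat \<Rightarrow> 'w \<Rightarrow> 'w \<Rightarrow> 'w list set"
  where "multichains W S E r x y =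
    {\<phi>\<in>lists E. length \<phi> = r + 2 \<and> \<phi> ! 0 = x \<and> \<phi> ! (r + 1) = y \<and>
      (\<forall>i\<le>r. bruhat_le W S (\<phi> ! i) (\<phi> ! (i + 1)))}"

definition index_set ::
  "'w set \<Rightarrow> ('w \<Rightarrow> 'g::linordered_ab_group_add) \<Rightarrow> nat \<Rightarrow> 'g \<Rightarrow> 'w list \<Rightarrow> 'g list set"
  where "index_set S L r \<gamma> \<phi> =
    {a\<in>lists (weight_group S L). length a = r + 2 \<and>
      a ! 0 = L (\<phi> ! (r + 1)) - L (\<phi> ! 0) - \<gamma> \<and>
      \<gamma> \<ge> a ! 1 \<and> (\<forall>i\<in>{1..r}. a ! i > a ! (i + 1)) \<and> a ! (r + 1) = 0 \<and>
      (\<forall>i\<in>{1..r}. a ! i > L (\<phi> ! (r + 1 - i)) - L (\<phi> ! 0) - a ! i \<and>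
        L (\<phi> ! (r + 1 - i)) - L (\<phi> ! 0) - a ! i \<ge> a ! (i + 1))}"

text \<open>
  The index set may be infinite (bounded subsets of \<open>\<Gamma>''\<close> need not be finite), but only finitely many
  of its members contribute a nonzero summand.  Sums over it are therefore taken with
  \<^const>\<open>Sum_any\<close>, which sums over the nonzero summands, instead of \<^const>\<open>sum\<close>, which would be
  \<open>0\<close> on an infinite set.
\<close>

end

theory Submission
  imports Defs
begin

text \<open>
  Barring the defining relations of \<open>P\<close> and inverting gives
  \<open>q\<^sub>x\<^sup>-\<^sup>1 q\<^sub>y (bar Q\<^bsub>x,y\<^esub>) = \<Sum>\<^sub>t Q\<^bsub>x,t\<^esub> R'\<^bsub>t,y\<^esub>\<close>, that is,
  \<open>[q\<^sup>\<gamma>] Q\<^bsub>x,y\<^esub> = \<Sum>\<^sub>t [q\<^bsup>L(y)-L(x)-\<gamma>\<^esup>] (Q\<^bsub>x,t\<^esub> R'\<^bsub>t,y\<^esub>)\<close>.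
  The bound \<open>2 deg Q\<^bsub>x,t\<^esub> < L(t) - L(x)\<close> and the bounds on the exponents of \<open>R'\<close> confine
  the exponents that contribute, and iterating the recursion produces the sum over multichains.
  After one step the exponent satisfies \<open>2\<gamma> < L(y) - L(x)\<close>, and then the term \<open>t = y\<close> vanishes;
  hence only the last step of a multichain can be stationary and the iteration stops after
  \<open>\<ell>(y) - \<ell>(x)\<close> steps.

  For \<open>x\<close> not below \<open>y\<close> one needs \<open>R\<^bsub>x,y\<^esub> = 0\<close>.  This follows by induction on \<open>\<ell>(y)\<close> from the
  action of the generators and the lifting property of the Bruhat order, which rests on the strong
  exchange condition; the latter is derived from the presentation by counting how often each
  reflection occurs along a word, modulo 2.
\<close>

section \<open>Strong exchange and the Bruhat order\<close>

context coxeter_system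
begin

section \<open>Words, inverses and length\<close>

abbreviation len :: "'w \<Rightarrow> nat" where "len \<equiv> cox_length W S"

lemma S_carrier: "s \<in> S \<Longrightarrow> s \<in> carrier W"
  using S_subset by blast

lemma word_prod_Nil [simp]: "word_prod W [] = \<one>"
  by (simp add: word_prod_def)

lemma word_prod_Cons [simp]: "word_prod W (s # ws) = s \<otimes> word_prod W ws"
  by (simp add: word_prod_def)

lemma word_prod_closed: "ws \<in> lists S \<Longrightarrow> word_prod W ws \<in> carrier W"
  by (induction ws) (auto intro: S_carrier)

lemma word_prod_append:
  "u \<in> lists S \<Longrightarrow> v \<in> lists S \<Longrightarrow> word_prod W (u @ v) = word_prod W u \<otimes> word_prod W v"
  by (induction u) (auto simp: S_carrier word_prod_closed m_assoc)

lemma S_square: 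
  assumes "s \<in> S" shows "s \<otimes> s = \<one>"
proof -
  obtain m where m: "coxeter_matrix S m"
    "\<And>u v. u \<in> lists S \<Longrightarrow> v \<in> lists S \<Longrightarrow> word_prod W u = word_prod W v \<longleftrightarrow> coxeter_cong S m u v"
    using presentation by metis
  have "m s s = 1" using m(1) assms by (simp add: coxeter_matrix_def)
  then have "coxeter_cong S m [s, s] []"
    using coxeter_cong.rel[of "[]" S "[]" s s m] assms by simp
  then have "word_prod W [s, s] = word_prod W []"
    using m(2)[of "[s, s]" "[]"] assms by (simp only: lists.intros)
  then show ?thesis using assms S_carrier by simp
qed

lemma S_inv: "s \<in> S \<Longrightarrow> inv s = s"
  by (simp add: S_carrier S_square inv_equality)

lemma S_cancel: "s \<in> S \<Longrightarrow> w \<in> carrier W \<Longrightarrow> s \<otimes> (s \<otimes> w) = w"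
  by (simp add: S_carrier S_square m_assoc[symmetric])

lemma word_prod_rev: "ws \<in> lists S \<Longrightarrow> word_prod W (rev ws) = inv (word_prod W ws)"
proof (induction ws)
  case (Cons s ws)
  then have s: "s \<in> S" and ws: "ws \<in> lists S" by auto
  then have "rev ws \<in> lists S" "[s] \<in> lists S" by auto
  then have "word_prod W (rev (s # ws)) = word_prod W (rev ws) \<otimes> s"
    using s S_carrier by (simp only: rev.simps word_prod_append) simp
  then show ?case
    using Cons.IH[OF ws] s ws word_prod_closed by (simp add: inv_mult_group S_inv S_carrier)
qed simp

lemma exists_word:
  assumes "w \<in> carrier W"
  shows "\<exists>ws\<in>lists S. word_prod W ws = w"
proof -
  have "w \<in> generate W S" using assms S_generates by simp
  then show ?thesis
  proof induction
    case one
    show ?case by (rule bexI[of _ "[]"]) auto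
  next
    case (incl h)
    then show ?case by (intro bexI[of _ "[h]"]) (auto simp: S_carrier)
  next
    case (inv h)
    then show ?case by (intro bexI[of _ "[h]"]) (auto simp: S_carrier S_inv)
  next
    case (eng h1 h2)
    then obtain u v where "u \<in> lists S" "v \<in> lists S" "word_prod W u = h1" "word_prod W v = h2"
      by blast
    then show ?case by (intro bexI[of _ "u @ v"]) (auto simp: word_prod_append)
  qed
qed

lemma reduced_exists:
  assumes "w \<in> carrier W"
  shows "\<exists>ws\<in>lists S. word_prod W ws = w \<and> length ws = len w"
proof -
  obtain v where "v \<in> lists S" "word_prod W v = w"
    using exists_word[OF assms] by blast
  then have "\<exists>ws\<in>lists S. word_prod W ws = w \<and> length ws = length v"
    by blast
  then show ?thesis
    unfolding cox_length_def by (rule LeastI)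
qed

lemma len_le: "ws \<in> lists S \<Longrightarrow> len (word_prod W ws) \<le> length ws"
  unfolding cox_length_def by (rule Least_le) blast

lemma len_S_le:
  assumes "s \<in> S" "w \<in> carrier W"
  shows "len (s \<otimes> w) \<le> Suc (len w)"
proof -
  obtain ws where "ws \<in> lists S" "word_prod W ws = w" "length ws = len w"
    using reduced_exists assms by blast
  then show ?thesis using len_le[of "s # ws"] assms by simp
qed

text \<open>For \<open>ws = s\<^sub>1 \<dots> s\<^sub>k\<close> this lists the reflections
  \<open>s\<^sub>1 \<dots> s\<^bsub>i-1\<^esub> s\<^sub>i s\<^bsub>i-1\<^esub> \<dots> s\<^sub>1\<close>.\<close>

fun refl_list :: "'w list \<Rightarrow> 'w list" where
  "refl_list [] = []"
| "refl_list (s # ws) = s # map (\<lambda>t. s \<otimes> t \<otimes> s) (refl_list ws)"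

lemma refl_list_closed: "ws \<in> lists S \<Longrightarrow> set (refl_list ws) \<subseteq> carrier W"
  by (induction ws) (auto simp: S_carrier subset_iff)

lemma conj_S_eq_iff:
  assumes "s \<in> S" "a \<in> carrier W" "t \<in> carrier W"
  shows "s \<otimes> a \<otimes> s = t \<longleftrightarrow> a = s \<otimes> t \<otimes> s"
proof -
  have "s \<otimes> (s \<otimes> b \<otimes> s) \<otimes> s = b" if "b \<in> carrier W" for b
    using that assms(1) by (simp add: S_carrier m_assoc S_square S_cancel)
  then show ?thesis using assms by metis
qed

lemma count_conj_S:
  assumes "s \<in> S" "t \<in> carrier W" "set l \<subseteq> carrier W"
  shows "count_list (map (\<lambda>t. s \<otimes> t \<otimes> s) l) t = count_list l (s \<otimes> t \<otimes> s)"
  using assms(3) by (induction l) (auto simp: conj_S_eq_iff[OF assms(1) _ assms(2)])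

text \<open>The reflections along \<open>u @ v\<close> are those along \<open>u\<close>, followed by
  the conjugates by the product of \<open>u\<close> of those along \<open>v\<close>. This cocycle
  rule makes the parity arguments below work letter by letter.\<close>

lemma count_refl_list_append:
  assumes "u \<in> lists S" "v \<in> lists S" "t \<in> carrier W"
  shows "count_list (refl_list (u @ v)) t =
    count_list (refl_list u) t + count_list (refl_list v) (inv (word_prod W u) \<otimes> t \<otimes> word_prod W u)"
  using assms
proof (induction u arbitrary: t)
  case Nil
  then show ?case by simp
next
  case (Cons s u)
  then have s: "s \<in> S" and u: "u \<in> lists S" by auto
  have st: "s \<otimes> t \<otimes> s \<in> carrier W" using s Cons.prems S_carrier by simp
  have conj_eq: "inv (word_prod W u) \<otimes> (s \<otimes> t \<otimes> s) \<otimes> word_prod W u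
      = inv (s \<otimes> word_prod W u) \<otimes> t \<otimes> (s \<otimes> word_prod W u)"
    using s u Cons.prems word_prod_closed by (simp add: S_carrier inv_mult_group S_inv m_assoc)
  have "count_list (refl_list (s # w)) t =
      (if s = t then count_list (refl_list w) (s \<otimes> t \<otimes> s) + 1 else count_list (refl_list w) (s \<otimes> t \<otimes> s))"
    if "w \<in> lists S" for w
    by (simp only: refl_list.simps count_list.simps
        count_conj_S[OF s Cons.prems(2) refl_list_closed[OF that]])
  from this[OF u] this[of "u @ v"] show ?case
    using Cons.IH[OF Cons.prems(1) st] s u Cons.prems(1) conj_eq
    by (simp only: append_Cons append_in_lists_conv word_prod_Cons simp_thms split: if_split) simp
qed

text \<open>In this closed form the list visibly becomes periodic as soon as a power of
  \<open>s \<otimes> t\<close> is trivial.\<close>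

lemma refl_list_alternating:
  assumes "s \<in> S" "t \<in> S"
  shows "refl_list (concat (replicate k [s, t])) = map (\<lambda>i. (s \<otimes> t) [^] i \<otimes> s) [0..<2 * k]"
proof (induction k)
  case 0
  then show ?case by simp
next
  case (Suc k)
  have c: "s \<in> carrier W" "t \<in> carrier W" using assms S_carrier by auto
  \<comment> \<open>Two letters are peeled off at once, and conjugation by \<open>t\<close> and then
    by \<open>s\<close> raises the exponent of \<open>s \<otimes> t\<close> by 2; the index range is
    split to match.\<close>
  have shift: "[0..<2 * Suc k] = 0 # 1 # map (\<lambda>i. i + 2) [0..<2 * k]"
    by (simp add: map_Suc_upt[symmetric] upt_conv_Cons comp_def del: upt_Suc)
  have "s \<otimes> (t \<otimes> ((s \<otimes> t) [^] i \<otimes> s) \<otimes> t) \<otimes> s = (s \<otimes> t) [^] (i + 2) \<otimes> s" for i :: nat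
  proof -
    have "s \<otimes> (t \<otimes> ((s \<otimes> t) [^] i \<otimes> s) \<otimes> t) \<otimes> s = ((s \<otimes> t) \<otimes> (s \<otimes> t) [^] i \<otimes> (s \<otimes> t)) \<otimes> s"
      using c by (simp add: m_assoc)
    also have "(s \<otimes> t) \<otimes> (s \<otimes> t) [^] i = (s \<otimes> t) [^] i \<otimes> (s \<otimes> t)"
      using c nat_pow_Suc nat_pow_Suc2[of "s \<otimes> t" i] by simp
    finally show ?thesis using c by simp
  qed
  then have "refl_list (concat (replicate (Suc k) [s, t])) =
     s # (s \<otimes> t \<otimes> s) # map (\<lambda>i. (s \<otimes> t) [^] (i + 2) \<otimes> s) [0..<2 * k]"
    using Suc by (simp add: comp_def)
  also have "\<dots> = map (\<lambda>i. (s \<otimes> t) [^] i \<otimes> s) (0 # 1 # map (\<lambda>i. i + 2) [0..<2 * k])"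
    using c by (simp add: comp_def)
  finally show ?case by (simp only: shift)
qed

lemma word_prod_alternating:
  assumes "s \<in> S" "t \<in> S"
  shows "word_prod W (concat (replicate k [s, t])) = (s \<otimes> t) [^] k"
proof (induction k)
  case (Suc k)
  have c: "s \<in> carrier W" "t \<in> carrier W" using assms S_carrier by auto
  then have "word_prod W (concat (replicate (Suc k) [s, t])) = (s \<otimes> t) \<otimes> (s \<otimes> t) [^] k"
    using Suc by (simp add: m_assoc)
  also have "\<dots> = (s \<otimes> t) [^] Suc k"
    using c nat_pow_Suc2[of "s \<otimes> t" k] by simp
  finally show ?case .
qed simp

lemma alternating_lists: "s \<in> S \<Longrightarrow> t \<in> S \<Longrightarrow> concat (replicate k [s, t]) \<in> lists S"
  by (induction k) auto

text \<open>The parity of the number of occurrences of a reflection is an invariant of the element: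
  in a Coxeter relator \<open>(st)\<^bsup>m\<^esup>\<close> the list of \<open>2m\<close> reflections has period \<open>m\<close>.\<close>

lemma even_count_refl_list_cong:
  assumes m: "\<And>u v. u \<in> lists S \<Longrightarrow> v \<in> lists S \<Longrightarrow> word_prod W u = word_prod W v \<longleftrightarrow> coxeter_cong S m u v"
    and "coxeter_cong S m u v"
  shows "u \<in> lists S \<and> v \<in> lists S \<and>
    (\<forall>r\<in>carrier W. even (count_list (refl_list u) r) \<longleftrightarrow> even (count_list (refl_list v) r))"
  using assms(2)
proof induction
  case (rel u v s t)
  let ?p = "concat (replicate (m s t) [s, t])"
  have c: "s \<in> carrier W" "t \<in> carrier W" using rel S_carrier by auto
  have p: "?p \<in> lists S" using rel alternating_lists by blast
  have "coxeter_cong S m ?p []"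
    using coxeter_cong.rel[of "[]" S "[]" s t m] rel by simp
  then have p1: "word_prod W ?p = \<one>"
    using m p by (metis word_prod_Nil lists.Nil)
  then have pow1: "(s \<otimes> t) [^] m s t = \<one>"
    using word_prod_alternating rel by simp
  have "[0..<2 * m s t] = [0..<m s t] @ map (\<lambda>i. i + m s t) [0..<m s t]"
    unfolding map_add_upt mult_2 by (rule upt_add_eq_append) simp
  moreover have "(s \<otimes> t) [^] (i + m s t) = (s \<otimes> t) [^] i" for i :: nat
    using c pow1 nat_pow_mult[of "s \<otimes> t" i "m s t", symmetric] by simp
  ultimately have "refl_list ?p = map (\<lambda>i. (s \<otimes> t) [^] i \<otimes> s) [0..<m s t] @
      map (\<lambda>i. (s \<otimes> t) [^] i \<otimes> s) [0..<m s t]"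
    using refl_list_alternating[OF rel(3,4), of "m s t"] by (simp add: comp_def)
  then have even: "even (count_list (refl_list ?p) r)" for r
    by simp
  have "even (count_list (refl_list (u @ ?p @ v)) r) \<longleftrightarrow> even (count_list (refl_list (u @ v)) r)"
    if r: "r \<in> carrier W" for r
  proof -
    \<comment> \<open>The relator has product one, so the reflections contributed by
      \<open>v\<close> are conjugated by the product of \<open>u\<close> alone, with or without the
      relator in front of \<open>v\<close>.\<close>
    define r' where "r' = inv (word_prod W u) \<otimes> r \<otimes> word_prod W u"
    have r': "r' \<in> carrier W" unfolding r'_def using r rel word_prod_closed by simp
    have "count_list (refl_list (?p @ v)) r' = count_list (refl_list ?p) r' + count_list (refl_list v) r'"
      using count_refl_list_append[OF p rel(2) r'] r' p1 by simp
    then show ?thesis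
      using count_refl_list_append[of u "?p @ v" r] count_refl_list_append[of u v r] rel r p even
      by (simp add: r'_def[symmetric])
  qed
  then show ?case using rel p by simp
qed auto

lemma even_count_refl_list:
  assumes "u \<in> lists S" "v \<in> lists S" "word_prod W u = word_prod W v" "r \<in> carrier W"
  shows "even (count_list (refl_list u) r) \<longleftrightarrow> even (count_list (refl_list v) r)"
proof -
  obtain m where
    m: "\<And>u v. u \<in> lists S \<Longrightarrow> v \<in> lists S \<Longrightarrow> word_prod W u = word_prod W v \<longleftrightarrow> coxeter_cong S m u v"
    using presentation by metis
  then show ?thesis
    using even_count_refl_list_cong[OF m, of u v] assms by blast
qed

section \<open>Reflections and the strong exchange condition\<close>

lemma reflection_closed: "t \<in> reflections W S \<Longrightarrow> t \<in> carrier W"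
  by (auto simp: reflections_def S_carrier)

text \<open>The palindrome \<open>u @ s # rev u\<close> serves. Since \<open>u @ rev u\<close>
  represents the identity, its two halves contribute an even number of occurrences of
  \<open>t\<close>, and the middle letter adds exactly one.\<close>

lemma reflection_word:
  assumes "t \<in> reflections W S"
  obtains v where "v \<in> lists S" "word_prod W v = t" "odd (count_list (refl_list v) t)"
proof -
  obtain w s where w: "w \<in> carrier W" "s \<in> S" "t = w \<otimes> s \<otimes> inv w"
    using assms by (auto simp: reflections_def)
  obtain u where u: "u \<in> lists S" "word_prod W u = w"
    using exists_word w by blast
  have t: "t \<in> carrier W" using assms reflection_closed by blast
  have us: "rev u \<in> lists S" using u by auto
  have wt: "inv w \<otimes> t \<otimes> w = s"
    using w S_carrier by (simp add: m_assoc) (simp add: m_assoc[symmetric])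
  have "even (count_list (refl_list (u @ rev u)) t) \<longleftrightarrow> even (count_list (refl_list []) t)"
    using u w t us by (intro even_count_refl_list) (auto simp: word_prod_append word_prod_rev)
  then have ev: "even (count_list (refl_list u) t + count_list (refl_list (rev u)) s)"
    using count_refl_list_append[OF u(1) us t] u wt by simp
  have "count_list (refl_list (s # rev u)) s = Suc (count_list (refl_list (rev u)) s)"
    using w us refl_list_closed[OF us] by (simp add: count_conj_S S_carrier S_square)
  moreover have "s # rev u \<in> lists S" using us w by simp
  ultimately have "odd (count_list (refl_list (u @ s # rev u)) t)"
    using count_refl_list_append[OF u(1) _ t, of "s # rev u"] u wt ev by simp
  moreover have "word_prod W (u @ s # rev u) = t"
    using u w us S_carrier by (simp add: word_prod_append word_prod_rev m_assoc)
  ultimately show thesis using that[of "u @ s # rev u"] u us w by simp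
qed

lemma reflection_square:
  assumes "t \<in> reflections W S" shows "t \<otimes> t = \<one>"
proof -
  obtain w s where w: "w \<in> carrier W" "s \<in> S" "t = w \<otimes> s \<otimes> inv w"
    using assms by (auto simp: reflections_def)
  have "inv w \<otimes> (w \<otimes> (s \<otimes> inv w)) = s \<otimes> inv w"
    using w S_carrier by (simp add: m_assoc[symmetric])
  then show ?thesis using w S_carrier by (simp add: m_assoc S_cancel)
qed

text \<open>Left multiplication by the reflection attached to a letter cancels precisely that
  letter.\<close>

lemma refl_list_deletion:
  assumes "ws \<in> lists S" "t \<in> set (refl_list ws)"
  shows "\<exists>i<length ws. t \<otimes> word_prod W ws = word_prod W (take i ws @ drop (Suc i) ws)"
  using assms
proof (induction ws arbitrary: t)
  case (Cons s ws)
  then have s: "s \<in> S" and ws: "ws \<in> lists S" by auto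
  note c = S_carrier[OF s] word_prod_closed[OF ws]
  consider "t = s" | t' where "t' \<in> set (refl_list ws)" "t = s \<otimes> t' \<otimes> s"
    using Cons.prems by auto
  then show ?case
  proof cases
    case 1
    then show ?thesis using s c by (intro exI[of _ 0]) (simp add: S_cancel)
  next
    case 2
    then obtain i where i: "i < length ws"
      "t' \<otimes> word_prod W ws = word_prod W (take i ws @ drop (Suc i) ws)"
      using Cons.IH ws by blast
    have "t' \<in> carrier W" using 2 refl_list_closed ws by blast
    then have "t \<otimes> word_prod W (s # ws) = s \<otimes> (t' \<otimes> word_prod W ws)"
      using 2 s c by (simp add: m_assoc S_cancel)
    then show ?thesis using i by (intro exI[of _ "Suc i"]) simp
  qed
qed simp

lemma delete_lists: "ws \<in> lists S \<Longrightarrow> take i ws @ drop (Suc i) ws \<in> lists S"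
  by (auto dest: in_set_takeD in_set_dropD)

lemma len_delete:
  assumes "ws \<in> lists S" "i < length ws"
  shows "len (word_prod W (take i ws @ drop (Suc i) ws)) < length ws"
proof -
  have "len (word_prod W (take i ws @ drop (Suc i) ws)) \<le> length (take i ws @ drop (Suc i) ws)"
    using len_le[OF delete_lists[OF assms(1)]] .
  then show ?thesis using assms(2) by simp
qed

text \<open>The parity depends only on the element, so \<open>t\<close> also occurs along a reduced
  word, where deleting a letter shortens the element.\<close>

lemma odd_count_shorter:
  assumes "t \<in> reflections W S" "ws \<in> lists S" "odd (count_list (refl_list ws) t)"
  shows "len (t \<otimes> word_prod W ws) < len (word_prod W ws)"
proof -
  obtain v where v: "v \<in> lists S" "word_prod W v = word_prod W ws" "length v = len (word_prod W ws)"
    using reduced_exists assms word_prod_closed by blast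
  have "odd (count_list (refl_list v) t)"
    using even_count_refl_list[OF v(1) assms(2) v(2)] assms reflection_closed by blast
  then have "count_list (refl_list v) t \<noteq> 0" by (metis even_zero)
  then have "t \<in> set (refl_list v)" by (simp add: count_list_0_iff)
  then obtain i where i: "i < length v" "t \<otimes> word_prod W v = word_prod W (take i v @ drop (Suc i) v)"
    using refl_list_deletion v by blast
  then show ?thesis using len_delete[OF v(1) i(1)] v by simp
qed

text \<open>If \<open>t\<close> occurred evenly often along \<open>ws\<close>, it would occur oddly
  often along \<open>v @ ws\<close>, and \<open>odd_count_shorter\<close> would make
  \<open>t \<otimes> word_prod W ws\<close> longer than \<open>word_prod W ws\<close>. The weak
  inequality in the hypothesis lets \<open>reflection_len_neq\<close> exclude equality
  afterwards.\<close>

lemma strong_exchange: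
  assumes t: "t \<in> reflections W S" and ws: "ws \<in> lists S"
    and less: "len (t \<otimes> word_prod W ws) \<le> len (word_prod W ws)"
  shows "\<exists>i<length ws. t \<otimes> word_prod W ws = word_prod W (take i ws @ drop (Suc i) ws)"
proof -
  obtain v where v: "v \<in> lists S" "word_prod W v = t" "odd (count_list (refl_list v) t)"
    using reflection_word t by blast
  note c = word_prod_closed[OF ws] reflection_closed[OF t]
  have "odd (count_list (refl_list ws) t)"
  proof (rule ccontr)
    assume "\<not> ?thesis"
    \<comment> \<open>Conjugation by the product \<open>t\<close> of the prefix \<open>v\<close>
      fixes \<open>t\<close>, so the two counts simply add.\<close>
    moreover have "inv t \<otimes> t \<otimes> t = t" using c by simp
    ultimately have "odd (count_list (refl_list (v @ ws)) t)"
      using count_refl_list_append[OF v(1) ws c(2)] v by simp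
    then have "len (t \<otimes> (t \<otimes> word_prod W ws)) < len (t \<otimes> word_prod W ws)"
      using odd_count_shorter[OF t, of "v @ ws"] v ws by (simp add: word_prod_append)
    moreover have "t \<otimes> (t \<otimes> word_prod W ws) = word_prod W ws"
      using c reflection_square[OF t] by (simp add: m_assoc[symmetric])
    ultimately show False using less by simp
  qed
  then have "count_list (refl_list ws) t \<noteq> 0" by (metis even_zero)
  then have "t \<in> set (refl_list ws)" by (simp add: count_list_0_iff)
  then show ?thesis using refl_list_deletion ws by blast
qed

lemma reflection_len_neq:
  assumes t: "t \<in> reflections W S" and w: "w \<in> carrier W"
  shows "len (t \<otimes> w) \<noteq> len w"
proof
  assume eq: "len (t \<otimes> w) = len w"
  obtain ws where ws: "ws \<in> lists S" "word_prod W ws = w" "length ws = len w"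
    using reduced_exists w by blast
  obtain i where i: "i < length ws" "t \<otimes> word_prod W ws = word_prod W (take i ws @ drop (Suc i) ws)"
    using strong_exchange[OF t ws(1)] eq ws by auto
  then show False using len_delete[OF ws(1) i(1)] eq ws by simp
qed

lemma S_reflection:
  assumes "s \<in> S" shows "s \<in> reflections W S"
proof -
  have "s = \<one> \<otimes> s \<otimes> inv \<one>" using assms S_carrier by simp
  then show ?thesis using assms unfolding reflections_def by blast
qed

lemma reflection_conj:
  assumes "t \<in> reflections W S" "w \<in> carrier W"
  shows "w \<otimes> t \<otimes> inv w \<in> reflections W S"
proof -
  obtain v s where v: "v \<in> carrier W" "s \<in> S" "t = v \<otimes> s \<otimes> inv v"
    using assms by (auto simp: reflections_def)
  then have "w \<otimes> t \<otimes> inv w = (w \<otimes> v) \<otimes> s \<otimes> inv (w \<otimes> v)"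
    using assms S_carrier by (simp add: m_assoc inv_mult_group)
  then show ?thesis using v assms unfolding reflections_def by blast
qed

text \<open>Bruhat steps multiply on the right, exchange acts on the left; this lemma and
  \<open>bruhat_step_left\<close> translate between the two.\<close>

lemma right_reflection:
  assumes "t \<in> reflections W S" "w \<in> carrier W"
  shows "\<exists>t'\<in>reflections W S. w \<otimes> t = t' \<otimes> w"
  using reflection_conj[OF assms] assms reflection_closed
  by (intro bexI[of _ "w \<otimes> t \<otimes> inv w"]) (auto simp: m_assoc)

section \<open>The Bruhat order and its lifting property\<close>

lemma bruhat_step_closed: "bruhat_step W S u v \<Longrightarrow> u \<in> carrier W \<and> v \<in> carrier W"
  by (auto simp: bruhat_step_def reflection_closed)

lemma bruhat_step_left:
  assumes "t \<in> reflections W S" "u \<in> carrier W" "len u < len (t \<otimes> u)"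
  shows "bruhat_step W S u (t \<otimes> u)"
proof -
  have "inv u \<otimes> t \<otimes> inv (inv u) \<in> reflections W S"
    using assms by (intro reflection_conj) auto
  moreover have "t \<otimes> u = u \<otimes> (inv u \<otimes> t \<otimes> inv (inv u))"
    using assms reflection_closed by (simp add: m_assoc[symmetric])
  ultimately show ?thesis using assms unfolding bruhat_step_def by blast
qed

lemma bruhat_le_refl: "bruhat_le W S u u"
  by (simp add: bruhat_le_def)

lemma bruhat_le_trans: "bruhat_le W S u v \<Longrightarrow> bruhat_le W S v w \<Longrightarrow> bruhat_le W S u w"
  by (simp add: bruhat_le_def)

lemma bruhat_step_le: "bruhat_step W S u v \<Longrightarrow> bruhat_le W S u v"
  by (simp add: bruhat_le_def)

lemma bruhat_le_cases:
  assumes "bruhat_le W S u v"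
  shows "u = v \<or> len u < len v"
  using assms unfolding bruhat_le_def
  by induction (auto simp: bruhat_step_def)

lemma bruhat_le_antisym: "bruhat_le W S u v \<Longrightarrow> bruhat_le W S v u \<Longrightarrow> u = v"
  using bruhat_le_cases[of u v] bruhat_le_cases[of v u] by auto

lemma bruhat_le_len: "bruhat_le W S u v \<Longrightarrow> len u \<le> len v"
  using bruhat_le_cases[of u v] by auto

lemma S_step_cases:
  assumes "s \<in> S" "u \<in> carrier W"
  shows "len (s \<otimes> u) < len u \<and> bruhat_step W S (s \<otimes> u) u \<or> len u < len (s \<otimes> u) \<and> bruhat_step W S u (s \<otimes> u)"
proof -
  have "len (s \<otimes> u) \<noteq> len u" using reflection_len_neq S_reflection assms by blast
  moreover have "bruhat_step W S (s \<otimes> u) u" if "len (s \<otimes> u) < len u"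
    using bruhat_step_left[OF S_reflection[OF assms(1)], of "s \<otimes> u"] that assms S_carrier
    by (simp add: S_cancel)
  moreover have "bruhat_step W S u (s \<otimes> u)" if "len u < len (s \<otimes> u)"
    using bruhat_step_left[OF S_reflection[OF assms(1)] assms(2) that] .
  ultimately show ?thesis by linarith
qed

text \<open>The same reflection \<open>t\<close> links \<open>s \<otimes> u\<close> to
  \<open>s \<otimes> v\<close>. If this is not an upward step and \<open>s\<close> does not shorten
  \<open>u\<close>, exchange on the word \<open>s # ws\<close> deletes a letter. Deleting one from
  \<open>ws\<close> would make \<open>v\<close> shorter than \<open>u\<close>, so \<open>s\<close>
  itself is deleted and \<open>s \<otimes> u = v\<close>.\<close>

lemma bruhat_step_S:
  assumes s: "s \<in> S" and step: "bruhat_step W S u v"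
  shows "bruhat_le W S (s \<otimes> u) v \<or> bruhat_le W S (s \<otimes> u) (s \<otimes> v)"
proof -
  obtain t where t: "t \<in> reflections W S" "v = u \<otimes> t" and less: "len u < len v"
    and u: "u \<in> carrier W"
    using step by (auto simp: bruhat_step_def)
  note c = S_carrier[OF s] u reflection_closed[OF t(1)]
  have v: "v \<in> carrier W" using c t by simp
  have sv: "s \<otimes> v = (s \<otimes> u) \<otimes> t" using c t by (simp add: m_assoc)
  show ?thesis
  proof (cases "len (s \<otimes> u) < len (s \<otimes> v)")
    case True
    then have "bruhat_step W S (s \<otimes> u) (s \<otimes> v)"
      using c t sv unfolding bruhat_step_def by auto
    then show ?thesis by (simp add: bruhat_step_le)
  next
    case le: False
    show ?thesis
    proof (cases "len (s \<otimes> u) < len u")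
      case True
      then have "bruhat_le W S (s \<otimes> u) u"
        using S_step_cases[OF s u] bruhat_step_le by force
      then show ?thesis using step bruhat_step_le bruhat_le_trans by blast
    next
      case False
      obtain ws where ws: "ws \<in> lists S" "word_prod W ws = u" "length ws = len u"
        using reduced_exists u by blast
      obtain t' where t': "t' \<in> reflections W S" "s \<otimes> v = t' \<otimes> (s \<otimes> u)"
        using right_reflection[OF t(1), of "s \<otimes> u"] c sv by auto
      have "s # ws \<in> lists S" using s ws by simp
      moreover have "len (t' \<otimes> word_prod W (s # ws)) \<le> len (word_prod W (s # ws))"
        using le t' ws by simp
      ultimately obtain i where i: "i < length (s # ws)"
        "t' \<otimes> word_prod W (s # ws) = word_prod W (take i (s # ws) @ drop (Suc i) (s # ws))"
        using strong_exchange[OF t'(1)] by blast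
      have "i = 0"
      proof (rule ccontr)
        assume "i \<noteq> 0"
        then obtain j where j: "i = Suc j" by (cases i) auto
        let ?d = "take j ws @ drop (Suc j) ws"
        have d: "?d \<in> lists S" by (rule delete_lists[OF ws(1)])
        have "s \<otimes> v = s \<otimes> word_prod W ?d"
          using i j t' ws by simp
        then have "v = word_prod W ?d"
          using s v word_prod_closed[OF d] S_cancel by metis
        then show False using len_delete[OF ws(1), of j] i j ws less by simp
      qed
      then have "s \<otimes> v = u" using i t' ws by simp
      then have "s \<otimes> u = v" using s v S_cancel by metis
      then show ?thesis by (simp add: bruhat_le_refl)
    qed
  qed
qed

lemma bruhat_le_S:
  assumes s: "s \<in> S" and "bruhat_le W S u v"
  shows "bruhat_le W S (s \<otimes> u) v \<or> bruhat_le W S (s \<otimes> u) (s \<otimes> v)"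
  using assms(2) unfolding bruhat_le_def
proof (induction)
  case (step v w)
  have "bruhat_le W S v w" using step(2) bruhat_step_le by blast
  then show ?case
    using step(3) bruhat_step_S[OF s step(2)] bruhat_le_trans
    unfolding bruhat_le_def[symmetric] by blast
qed simp

lemma bruhat_lifting:
  assumes "s \<in> S" "v \<in> carrier W" "bruhat_le W S u v" "len v < len (s \<otimes> v)"
  shows "bruhat_le W S u (s \<otimes> v)" "bruhat_le W S (s \<otimes> u) (s \<otimes> v)"
proof -
  have "bruhat_le W S v (s \<otimes> v)"
    using S_step_cases[OF assms(1,2)] assms(4) bruhat_step_le by auto
  then show "bruhat_le W S u (s \<otimes> v)" "bruhat_le W S (s \<otimes> u) (s \<otimes> v)"
    using bruhat_le_S[OF assms(1,3)] assms(3) bruhat_le_trans by blast+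
qed

text \<open>By strong exchange, every step down from \<open>v\<close> deletes a letter of a fixed
  reduced word, so there are finitely many. Finiteness is what gives the sums over Bruhat intervals
  their meaning.\<close>

lemma finite_bruhat_lower:
  assumes "v \<in> carrier W"
  shows "finite {u. bruhat_le W S u v}"
  using assms
proof (induction "len v" arbitrary: v rule: less_induct)
  case less
  obtain ws where ws: "ws \<in> lists S" "word_prod W ws = v" "length ws = len v"
    using reduced_exists less.prems by blast
  let ?D = "(\<lambda>i. word_prod W (take i ws @ drop (Suc i) ws)) ` {..<length ws}"
  have D: "u \<in> ?D" if "bruhat_step W S u v" for u
  proof -
    obtain t where t: "t \<in> reflections W S" "v = u \<otimes> t" "len u < len v" "u \<in> carrier W"
      using \<open>bruhat_step W S u v\<close> by (auto simp: bruhat_step_def)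
    obtain t' where t': "t' \<in> reflections W S" "v = t' \<otimes> u"
      using right_reflection t by metis
    have "t' \<otimes> v = u"
      using t' t reflection_square reflection_closed by (simp add: m_assoc[symmetric])
    then show ?thesis using strong_exchange[OF t'(1) ws(1)] ws t by auto
  qed
  have "{u. bruhat_le W S u v} \<subseteq> insert v (\<Union>w\<in>{w. bruhat_step W S w v}. {u. bruhat_le W S u w})"
  proof
    fix u assume "u \<in> {u. bruhat_le W S u v}"
    then show "u \<in> insert v (\<Union>w\<in>{w. bruhat_step W S w v}. {u. bruhat_le W S u w})"
      unfolding bruhat_le_def mem_Collect_eq by (cases rule: rtranclp.cases) auto
  qed
  moreover have "finite {w. bruhat_step W S w v}"
  proof (rule finite_subset)
    show "{w. bruhat_step W S w v} \<subseteq> ?D"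
      by (intro subsetI D) simp
    show "finite ?D" by (intro finite_imageI finite_lessThan)
  qed
  moreover have "finite {u. bruhat_le W S u w}" if "bruhat_step W S w v" for w
  proof (rule less.hyps)
    show "len w < len v" using that by (simp add: bruhat_step_def)
    show "w \<in> carrier W" using that bruhat_step_closed by blast
  qed
  ultimately show ?case by (simp add: finite_subset)
qed

end

section \<open>The group ring\<close>

lemma q_mult_q: "q a * q b = q (a + b)"
  by (simp add: q_def mult_single)

lemma q_zero: "q 0 = 1"
  by (simp add: q_def)

lemma eps_square: "eps W S w * eps W S w = (1 :: 'r::comm_ring_1)"
  by (simp add: eps_def power_mult_distrib[symmetric])

abbreviation (input) "lookup \<equiv> Poly_Mapping.lookup"

text \<open>The set \<open>K\<close> is left free so that the sum can later run over the exponents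
  singled out by degree bounds instead of over all of \<open>keys g\<close>.\<close>

lemma lookup_times:
  fixes f g :: "'g::linordered_ab_group_add zgr"
  assumes "finite K" "\<And>b. lookup f (e - b) \<noteq> 0 \<Longrightarrow> lookup g b \<noteq> 0 \<Longrightarrow> b \<in> K"
  shows "lookup (f * g) e = (\<Sum>b\<in>K. lookup f (e - b) * lookup g b)"
proof -
  have g: "g = (\<Sum>b\<in>Poly_Mapping.keys g. Poly_Mapping.single b (lookup g b))"
    by (rule poly_mapping_eqI) (auto simp: lookup_sum lookup_single when_def in_keys_iff)
  have "f * g = (\<Sum>b\<in>Poly_Mapping.keys g. Poly_Mapping.single b (lookup g b)) * f"
    using arg_cong[OF g, of "\<lambda>h. h * f"] by (simp only: mult.commute[of f])
  then have "lookup (f * g) e = (\<Sum>b\<in>Poly_Mapping.keys g. lookup g b * lookup f (e - b))"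
    by (simp only: sum_distrib_right lookup_sum lookup_single_times)
  also have "\<dots> = (\<Sum>b\<in>Poly_Mapping.keys g. lookup f (e - b) * lookup g b)"
    by (simp only: mult.commute)
  also have "\<dots> = (\<Sum>b\<in>K. lookup f (e - b) * lookup g b)"
    using assms by (intro sum.mono_neutral_cong) (auto simp: in_keys_iff)
  finally show ?thesis .
qed

lemma lookup_q_times: "lookup (q k * g) e = lookup g (e - k)" for g :: "'g::linordered_ab_group_add zgr"
  by (simp add: q_def lookup_single_times)

lemma eps_cases: "eps W S w = (1 :: 'r::comm_ring_1) \<or> eps W S w = (- 1 :: 'r)"
  by (simp add: eps_def minus_one_power_iff)

lemma qbar_zero: "qbar 0 = (0 :: 'g::linordered_ab_group_add zgr)"
  by (rule poly_mapping_eqI) (simp add: lookup_qbar)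

lemma qbar_one: "qbar 1 = (1 :: 'g::linordered_ab_group_add zgr)"
  using qbar_q[of 0] by (simp add: q_zero)

lemma qbar_uminus: "qbar (- f) = - qbar (f :: 'g::linordered_ab_group_add zgr)"
  by (rule poly_mapping_eqI) (simp add: lookup_qbar)

lemma qbar_qbar: "qbar (qbar f) = (f :: 'g::linordered_ab_group_add zgr)"
  by (rule poly_mapping_eqI) (simp add: lookup_qbar)

lemma qbar_sum: "qbar (sum f A) = (\<Sum>a\<in>A. qbar (f a :: 'g::linordered_ab_group_add zgr))"
  by (induction A rule: infinite_finite_induct) (auto simp: qbar_zero qbar_add)

lemma qbar_eps: "qbar (eps W S w) = (eps W S w :: 'g::linordered_ab_group_add zgr)"
  using eps_cases[of W S w, where 'r = "'g zgr"] by (auto simp: qbar_uminus qbar_one)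

lemma lookup_eps_times_eq_0_iff:
  "lookup (eps W S w * f) e = 0 \<longleftrightarrow> lookup (f :: 'g::linordered_ab_group_add zgr) e = 0"
  using eps_cases[of W S w, where 'r = "'g zgr"] by auto

lemma lookup_le_deg: "lookup f e \<noteq> 0 \<Longrightarrow> e \<le> deg (f :: 'g::linordered_ab_group_add zgr)"
  unfolding deg_def by (intro Max_ge) (auto simp: in_keys_iff)

section \<open>Triangularity of the bar involution\<close>

context w_graph_ideal
begin

lemma E_carrier: "y \<in> E \<Longrightarrow> y \<in> carrier W"
  using E_subset by blast

text \<open>The ideal property speaks of suffixes, so lengths must add exactly. This requires
  \<open>len s = 1\<close>: a generator of length 0 would be the identity and could not shorten
  \<open>y\<close>.\<close>

lemma E_descent:
  assumes y: "y \<in> E" and s: "s \<in> S" and less: "len (s \<otimes> y) < len y"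
  shows "s \<otimes> y \<in> E" "len y = Suc (len (s \<otimes> y))"
proof -
  have c: "y \<in> carrier W" "s \<in> carrier W" using y s E_carrier S_carrier by auto
  have y_eq: "y = s \<otimes> (s \<otimes> y)" using s c S_cancel by simp
  then have "len y \<le> Suc (len (s \<otimes> y))"
    using len_S_le[OF s, of "s \<otimes> y"] c by simp
  then show len: "len y = Suc (len (s \<otimes> y))" using less by simp
  have "len s = 1"
  proof -
    have "len s \<le> 1" using len_le[of "[s]"] s c by simp
    moreover have "len y \<le> len s + len (s \<otimes> y)" if len0: "len s = 0"
    proof -
      obtain ws where "ws \<in> lists S" "word_prod W ws = s" "length ws = 0"
        using reduced_exists[OF c(2)] len0 by auto
      then have "s = \<one>" by (metis length_0_conv word_prod_Nil)
      then show ?thesis using c by simp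
    qed
    ultimately show ?thesis using len by linarith
  qed
  then have "suffix_le W S (s \<otimes> y) y"
    unfolding suffix_le_def using c y_eq len by (intro bexI[of _ s]) auto
  then show "s \<otimes> y \<in> E" using E_ideal[OF y] c by simp
qed

lemma act_zero: "act a 0 = 0"
  using act_add_right[of a 0 0] by simp

lemma act_span:
  assumes "\<And>b. b \<in> A \<Longrightarrow> act a b \<in> M.span C" "m \<in> M.span A"
  shows "act a m \<in> M.span C"
  using assms(2)
proof (induction rule: M.span_induct_alt)
  case base
  then show ?case by (simp add: act_zero M.span_zero)
next
  case (step c b m)
  then show ?case
    by (simp add: act_add_right act_scale_right M.span_add M.span_scale assms(1))
qed

text \<open>All four cases of the action produce only basis elements below
  \<open>s \<otimes> x\<close> or below \<open>x\<close>. The form with an arbitrary span as target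
  fits \<open>act_span\<close>.\<close>

lemma act_T_B:
  assumes s: "s \<in> S" and x: "x \<in> E"
    and below: "\<And>z. z \<in> E \<Longrightarrow> bruhat_le W S z (s \<otimes> x) \<or> bruhat_le W S z x \<Longrightarrow> B z \<in> M.span C"
  shows "act (T s) (B x) \<in> M.span C"
proof -
  have c: "x \<in> carrier W" using x E_carrier by simp
  have Bx: "B x \<in> M.span C" using below x bruhat_le_refl by blast
  consider "s \<in> SD W S x" | "s \<in> SA W S E x" | "s \<in> WD W S J x" | "s \<in> WA W S E J x"
    using S_step_cases[OF s c] s unfolding SD_def SA_def WD_def WA_def by blast
  then show ?thesis
  proof cases
    case 1
    then have "s \<otimes> x \<in> E" using E_descent[OF x s] by (simp add: SD_def)
    then have "B (s \<otimes> x) \<in> M.span C" using below bruhat_le_refl by blast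
    then show ?thesis using act_SD[OF x 1] Bx by (simp add: M.span_add M.span_scale)
  next
    case 2
    then have "s \<otimes> x \<in> E" by (simp add: SA_def)
    then show ?thesis using act_SA[OF x 2] below bruhat_le_refl by simp
  next
    case 3
    then show ?thesis using act_WD[OF x 3] Bx by (simp add: M.span_neg)
  next
    case 4
    obtain r where r: "act (T s) (B x) =
        mscale (q (L s)) (B x) - (\<Sum>z | z \<in> E \<and> bruhat_less W S z (s \<otimes> x). mscale (r z) (B z))"
      using act_WA[OF x 4] by blast
    have "(\<Sum>z | z \<in> E \<and> bruhat_less W S z (s \<otimes> x). mscale (r z) (B z)) \<in> M.span C"
      using below by (intro M.span_sum M.span_scale) (auto simp: bruhat_less_def)
    then show ?thesis unfolding r using Bx by (intro M.span_diff M.span_scale)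
  qed
qed

text \<open>For a first letter \<open>s\<close> of a reduced word and
  \<open>y' = s \<otimes> y\<close>, \<open>B y\<close> is \<open>T s\<close> applied to
  \<open>B y'\<close>, and the bar of \<open>T s\<close> is a combination of \<open>T s\<close> and
  1. Applying \<open>T s\<close> to the support below \<open>y'\<close> stays below \<open>y\<close>
  by the lifting property.\<close>

lemma mbar_B_span:
  assumes "y \<in> E"
  shows "mbar (B y) \<in> M.span (B ` {x \<in> E. bruhat_le W S x y})"
  using assms
proof (induction "len y" arbitrary: y rule: less_induct)
  case less
  note y = less.prems
  have c: "y \<in> carrier W" using y E_carrier by simp
  obtain ws where ws: "ws \<in> lists S" "word_prod W ws = y" "length ws = len y"
    using reduced_exists c by blast
  show ?case
  proof (cases ws)
    case Nil
    then have "y = \<one>" using ws by simp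
    then show ?thesis using mbar_one y by (auto intro!: M.span_base bruhat_le_refl)
  next
    case (Cons s ws')
    then have s: "s \<in> S" and ws': "ws' \<in> lists S" using ws by auto
    define y' where "y' = s \<otimes> y"
    have "y' = word_prod W ws'"
      unfolding y'_def using Cons s ws ws' word_prod_closed S_cancel by auto
    then have "len y' < len y" using len_le[OF ws'] ws Cons by simp
    then have y': "y' \<in> E" "len y' < len y" unfolding y'_def using E_descent y s by auto
    have sy': "s \<otimes> y' = y" unfolding y'_def using s c S_cancel by simp
    have c': "y' \<in> carrier W" "s \<in> carrier W" using y' E_carrier s S_carrier by auto
    have "s \<in> SA W S E y'" unfolding SA_def using s y y' sy' by simp
    then have "B y = act (T s) (B y')" using act_SA[OF y'(1)] sy' by simp
    then have "mbar (B y) = act (hbar (T s)) (mbar (B y'))"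
      using mbar_act[OF c'(2) y'(1)] by simp
    also have "\<dots> = mscale (q (- L s)) (act (T s) (mbar (B y'))) + mscale (q (- L s) - 1) (mbar (B y'))"
      using s by (simp add: hbar_T act_add_left act_scale_left act_one)
    also have "\<dots> \<in> M.span (B ` {x \<in> E. bruhat_le W S x y})" (is "_ \<in> ?V")
    proof -
      have IH: "mbar (B y') \<in> M.span (B ` {x \<in> E. bruhat_le W S x y'})"
        using less.hyps y' by blast
      have le: "bruhat_le W S y' y" "x \<in> E \<Longrightarrow> bruhat_le W S x y' \<Longrightarrow> bruhat_le W S (s \<otimes> x) y" for x
        using bruhat_lifting[OF s c'(1)] y'(2) sy' bruhat_le_refl by auto
      have "act (T s) (mbar (B y')) \<in> ?V"
      proof (rule act_span[OF _ IH])
        fix b assume "b \<in> B ` {x \<in> E. bruhat_le W S x y'}"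
        then obtain x where x: "b = B x" "x \<in> E" "bruhat_le W S x y'" by blast
        show "act (T s) b \<in> ?V"
          unfolding x(1)
        proof (rule act_T_B[OF s x(2)])
          fix z assume "z \<in> E" "bruhat_le W S z (s \<otimes> x) \<or> bruhat_le W S z x"
          then have "bruhat_le W S z y"
            using le x bruhat_le_trans by blast
          then show "B z \<in> ?V" using \<open>z \<in> E\<close> by (intro M.span_base) auto
        qed
      qed
      moreover have "mbar (B y') \<in> ?V"
        by (rule subsetD[OF M.span_mono IH]) (use le(1) bruhat_le_trans in blast)
      ultimately show ?thesis by (intro M.span_add M.span_scale)
    qed
    finally show ?thesis .
  qed
qed

text \<open>Linear independence turns the span statement into a vanishing coordinate at
  \<open>B x\<close>, which is \<open>R x y\<close> up to signs and the unit
  \<open>q (- L y)\<close>.\<close>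

lemma R_eq_0:
  assumes R: "is_R_family W S L mscale E B mbar R"
    and x: "x \<in> E" and y: "y \<in> E" and nle: "\<not> bruhat_le W S x y"
  shows "R x y = 0"
proof (rule ccontr)
  assume nz: "R x y \<noteq> 0"
  define A where "A = {x \<in> E. R x y \<noteq> 0}"
  define c where "c x = (eps W S x * eps W S y * q (- L y) * R x y :: 'g zgr)" for x
  have A: "finite A" "mbar (B y) = (\<Sum>x\<in>A. mscale (c x) (B x))"
    using R y unfolding is_R_family_def A_def c_def by auto
  let ?X = "{x \<in> E. bruhat_le W S x y}"
  have sub: "?X \<subseteq> E" "A \<subseteq> E" by (auto simp: A_def)
  have rep: "M.representation (B ` E) (mbar (B y)) (B x) = 0"
  proof -
    have "M.representation (B ` E) (mbar (B y)) = M.representation (B ` ?X) (mbar (B y))"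
      \<comment> \<open>The coordinates can be computed in the smaller independent set, where
        \<open>B x\<close> does not occur.\<close>
      by (rule M.representation_extend[OF B_independent mbar_B_span[OF y]]) auto
    moreover have "B x \<notin> B ` ?X"
      using inj_on_image_mem_iff[OF B_inj x sub(1)] nle by simp
    ultimately show ?thesis
      using M.representation_ne_zero[of "B ` ?X" "mbar (B y)" "B x"] by auto
  qed
  have "M.representation (B ` E) (mbar (B y)) (B x) = (\<Sum>z\<in>A. M.representation (B ` E) (mscale (c z) (B z)) (B x))"
    unfolding A(2) using B_independent B_span by (subst M.representation_sum) auto
  also have "\<dots> = (\<Sum>z\<in>A. if z = x then c z else 0)"
  proof (rule sum.cong[OF HOL.refl])
    fix z assume "z \<in> A"
    then have z: "z \<in> E" using sub by blast
    then have "(B z = B x) = (z = x)" using B_inj x by (auto dest: inj_onD)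
    then show "M.representation (B ` E) (mscale (c z) (B z)) (B x) = (if z = x then c z else 0)"
      using z B_independent B_span by (auto simp: M.representation_scale M.representation_basis)
  qed
  also have "\<dots> = c x" using A(1) x nz by (simp add: A_def)
  finally have "c x = 0" using rep by simp
  moreover have "R x y = eps W S x * eps W S y * q (L y) * c x"
  proof -
    have "eps W S x * eps W S y * q (L y) * c x
      = (eps W S x * eps W S x) * (eps W S y * eps W S y) * (q (L y) * q (- L y)) * R x y"
      by (simp add: c_def algebra_simps)
    then show ?thesis by (simp add: eps_square q_mult_q q_zero)
  qed
  ultimately show False using nz by simp
qed

end

section \<open>Incidence algebra and the recursion for the inverse polynomials\<close>

lemma (in weighted_coxeter_system) weight_closed:
  assumes "w \<in> carrier W" shows "L w \<in> weight_group S L"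
proof -
  obtain ws where ws: "ws \<in> lists S" "word_prod W ws = w" "length ws = len w"
    using reduced_exists assms by blast
  then have "L w = sum_list (map L ws)"
    using weight_reduced[of ws] by (simp add: reduced_word_def)
  moreover have "sum_list (map L ws) \<in> weight_group S L"
    using ws(1) unfolding weight_group_def
    by (induction ws) (auto intro!: group_closure_add intro: group_closure.base)
  ultimately show ?thesis by simp
qed

lemma weight_group_diff:
  "a \<in> weight_group S L \<Longrightarrow> b \<in> weight_group S L \<Longrightarrow> a - b \<in> weight_group S L"
  unfolding weight_group_def by (rule group_closure.diff)

lemma weight_group_zero: "0 \<in> weight_group S L"
  unfolding weight_group_def by simp

text \<open>From here on the module matters only through the relations between \<open>R\<close>,
  \<open>R'\<close>, \<open>P\<close> and \<open>Q\<close>, so the Hecke algebra and its action are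
  left behind.\<close>

locale kl_setting = weighted_coxeter_system W S L
  for W :: "('w, 'k) monoid_scheme" (structure) and S
    and L :: "'w \<Rightarrow> 'g::linordered_ab_group_add" +
  fixes E :: "'w set" and R R' P Q :: "'w \<Rightarrow> 'w \<Rightarrow> 'g zgr"
  assumes E_carrier: "E \<subseteq> carrier W"
    and R_exponents: "R_exponents_bounded W S L E R"
    and R': "is_dual_R_family W S L E R R'"
    and P: "is_KL_family W S L E R P"
    and Q: "is_inverse_KL_family W S E P Q"
begin

definition interval :: "'w \<Rightarrow> 'w \<Rightarrow> 'w set"
  where "interval x y = {t. t \<in> E \<and> bruhat_le W S x t \<and> bruhat_le W S t y}"

lemma mem_interval: "t \<in> interval x y \<longleftrightarrow> t \<in> E \<and> bruhat_le W S x t \<and> bruhat_le W S t y"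
  by (simp add: interval_def)

lemma finite_interval: "y \<in> E \<Longrightarrow> finite (interval x y)"
  using finite_bruhat_lower[of y] E_carrier
  by (auto simp: interval_def intro: rev_finite_subset)

lemma interval_self: "x \<in> E \<Longrightarrow> interval x x = {x}"
  by (auto simp: mem_interval bruhat_le_refl intro: bruhat_le_antisym)

text \<open>The product of the incidence algebra of \<open>E\<close> under the Bruhat order, with
  coefficients in the group ring.\<close>

definition conv :: "('w \<Rightarrow> 'w \<Rightarrow> 'g zgr) \<Rightarrow> ('w \<Rightarrow> 'w \<Rightarrow> 'g zgr) \<Rightarrow> 'w \<Rightarrow> 'w \<Rightarrow> 'g zgr"
  where "conv f g x y = (\<Sum>t\<in>interval x y. f x t * g t y)"

lemma conv_assoc:
  assumes "y \<in> E"
  shows "conv (conv f g) h x y = conv f (conv g h) x y"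
proof -
  let ?I = "interval x y"
  have fin: "finite ?I" using assms finite_interval by simp
  have "conv (conv f g) h x y = (\<Sum>t\<in>?I. \<Sum>u\<in>{u \<in> ?I. bruhat_le W S u t}. f x u * g u t * h t y)"
    unfolding conv_def
    by (intro sum.cong HOL.refl)
      (auto simp: sum_distrib_right mem_interval intro!: sum.cong intro: bruhat_le_trans)
  also have "\<dots> = (\<Sum>u\<in>?I. \<Sum>t\<in>{t \<in> ?I. bruhat_le W S u t}. f x u * g u t * h t y)"
    by (rule sum.swap_restrict[OF fin fin])
  also have "\<dots> = conv f (conv g h) x y"
    unfolding conv_def
    by (intro sum.cong HOL.refl)
      (auto simp: sum_distrib_left mem_interval mult.assoc intro!: sum.cong intro: bruhat_le_trans)
  finally show ?thesis .
qed

lemma P_props: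
  assumes "x \<in> E" "y \<in> E"
  shows "P x x = 1"
    and "bruhat_less W S x y \<Longrightarrow> P x y = 0 \<or> deg (P x y) + deg (P x y) < L y - L x"
    and "q (- L x) * q (L y) * qbar (P x y) = conv R P x y"
  using P assms unfolding is_KL_family_def conv_def interval_def by auto

text \<open>\<open>P\<close> is unitriangular, hence cancellable on the right: the value at
  \<open>y\<close> is determined by the convolution and by the values at shorter elements of the
  interval.\<close>

lemma conv_P_cancel:
  assumes "x \<in> E" "y \<in> E" "bruhat_le W S x y"
    and "\<And>y. y \<in> E \<Longrightarrow> bruhat_le W S x y \<Longrightarrow> conv f P x y = conv g P x y"
  shows "f x y = g x y"
  using assms(2,3)
proof (induction "len y" arbitrary: y rule: less_induct)
  case less
  let ?I = "interval x y - {y}"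
  have mem: "y \<in> interval x y" using less by (simp add: mem_interval bruhat_le_refl)
  have expand: "conv h P x y = h x y + (\<Sum>t\<in>?I. h x t * P t y)" for h
    unfolding conv_def using less P_props(1)[of y y]
    by (simp add: sum.remove[OF finite_interval mem])
  have "(\<Sum>t\<in>?I. f x t * P t y) = (\<Sum>t\<in>?I. g x t * P t y)"
  proof (rule sum.cong[OF HOL.refl])
    fix t assume "t \<in> ?I"
    then have t: "t \<in> E" "bruhat_le W S x t" "bruhat_le W S t y" "t \<noteq> y" by (auto simp: mem_interval)
    then show "f x t * P t y = g x t * P t y"
      using less.hyps[of t] bruhat_le_cases[of t y] by simp
  qed
  then show ?case using assms(4)[OF less.prems] expand[of f] expand[of g] by simp
qed

text \<open>Barring reverses exponents, so up to sign \<open>R'\<close> has the coefficients of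
  \<open>R\<close> read backwards within degrees 0 to \<open>L y - L x\<close>.\<close>

lemma lookup_R':
  assumes "x \<in> E" "y \<in> E"
  shows "lookup (R' x y) e = lookup (eps W S x * eps W S y * R x y) (L y - L x - e)"
proof -
  have "qbar (R x y) = eps W S x * eps W S y * q (L x - L y) * R' x y"
    using R' assms q_mult_q[of "L x" "- L y"] unfolding is_dual_R_family_def by (simp add: mult.assoc)
  then have "eps W S x * eps W S y * qbar (R x y)
      = (eps W S x * eps W S x) * (eps W S y * eps W S y) * (q (L x - L y) * R' x y)"
    by (simp add: algebra_simps)
  then have "q (L x - L y) * R' x y = qbar (eps W S x * eps W S y * R x y)"
    by (simp add: eps_square qbar_mult qbar_eps)
  then have "lookup (q (L x - L y) * R' x y) (e + (L x - L y)) = lookup (eps W S x * eps W S y * R x y) (- (e + (L x - L y)))"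
    by (simp add: lookup_qbar)
  moreover have "- (e + (L x - L y)) = L y - L x - e" "e + (L x - L y) - (L x - L y) = e"
    by simp_all
  ultimately show ?thesis by (simp only: lookup_q_times)
qed

lemma R'_exponents:
  assumes "x \<in> E" "y \<in> E" "bruhat_le W S x y" "lookup (R' x y) e \<noteq> 0"
  shows "e \<in> weight_group S L" "e \<le> L y - L x"
proof -
  have "L y - L x - e \<in> Poly_Mapping.keys (R x y)"
    using assms lookup_R'[of x y e] by (simp add: in_keys_iff mult.assoc lookup_eps_times_eq_0_iff)
  then have *: "L y - L x - e \<in> weight_group S L" "0 \<le> L y - L x - e"
    using R_exponents assms unfolding R_exponents_bounded_def by blast+
  show "e \<le> L y - L x" using *(2) by simp
  have "L y - L x \<in> weight_group S L"
    using assms E_carrier by (intro weight_group_diff weight_closed) auto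
  from weight_group_diff[OF this *(1)] show "e \<in> weight_group S L" by simp
qed

section \<open>Bar relation and degree bound for the inverse polynomials\<close>

text \<open>With the signs absorbed, this is the inverse of \<open>P\<close> under
  \<open>conv\<close>.\<close>

definition signed_Q :: "'w \<Rightarrow> 'w \<Rightarrow> 'g zgr"
  where "signed_Q x y = eps W S x * eps W S y * Q x y"

lemma conv_signed_Q_P:
  assumes "x \<in> E" "y \<in> E"
  shows "conv signed_Q P x y = (if x = y then 1 else 0)"
proof -
  have "eps W S x * eps W S y * (\<Sum>t\<in>interval x y. eps W S t * eps W S y * Q x t * P t y)
      = eps W S x * eps W S y * (if x = y then 1 else 0)"
    using Q assms unfolding is_inverse_KL_family_def interval_def by simp
  also have "\<dots> = (if x = y then 1 else 0)"
    by (simp add: eps_square)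
  also have "eps W S x * eps W S y * (\<Sum>t\<in>interval x y. eps W S t * eps W S y * Q x t * P t y)
      = (\<Sum>t\<in>interval x y. (eps W S y * eps W S y) * (signed_Q x t * P t y))"
    by (simp add: sum_distrib_left signed_Q_def algebra_simps)
  finally show ?thesis by (simp add: conv_def eps_square)
qed

lemma signed_Q_refl: "x \<in> E \<Longrightarrow> signed_Q x x = 1"
  using conv_signed_Q_P[of x x] P_props(1)[of x x] by (simp add: conv_def interval_self)

lemma Q_refl: "x \<in> E \<Longrightarrow> Q x x = 1"
  using signed_Q_refl[of x] by (simp add: signed_Q_def eps_square)

lemma Q_not_le: "x \<in> E \<Longrightarrow> y \<in> E \<Longrightarrow> \<not> bruhat_le W S x y \<Longrightarrow> Q x y = 0"
  using Q unfolding is_inverse_KL_family_def by blast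

text \<open>After convolution with \<open>P\<close>, the defining relation of \<open>P\<close>
  replaces \<open>conv R P\<close> by a shifted bar of \<open>P\<close>. The shifts telescope to
  \<open>q (L y - L x)\<close> times the bar of \<open>conv signed_Q P\<close>, which is the
  identity of the incidence algebra; on the diagonal the shift is 1. Then \<open>P\<close> is
  cancelled.\<close>

lemma signed_Q_eq:
  assumes "x \<in> E" "y \<in> E" "bruhat_le W S x y"
  shows "signed_Q x y = conv (\<lambda>x t. q (L t - L x) * qbar (signed_Q x t)) R x y"
proof (rule conv_P_cancel[OF assms])
  fix y assume y: "y \<in> E"
  let ?A = "\<lambda>x t. q (L t - L x) * qbar (signed_Q x t)"
  have "conv (conv ?A R) P x y = conv ?A (conv R P) x y"
    by (rule conv_assoc[OF y])
  also have "\<dots> = (\<Sum>t\<in>interval x y. q (L y - L x) * qbar (signed_Q x t * P t y))"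
    unfolding conv_def[of ?A]
  proof (rule sum.cong[OF HOL.refl])
    fix t assume "t \<in> interval x y"
    then have t: "t \<in> E" by (simp add: mem_interval)
    have "q (L t - L x) * qbar (signed_Q x t) * conv R P t y
        = (q (L t - L x) * (q (- L t) * q (L y))) * (qbar (signed_Q x t) * qbar (P t y))"
      unfolding P_props(3)[OF t y, symmetric] by (simp add: algebra_simps)
    then show "q (L t - L x) * qbar (signed_Q x t) * conv R P t y = q (L y - L x) * qbar (signed_Q x t * P t y)"
      by (simp add: q_mult_q qbar_mult)
  qed
  also have "\<dots> = q (L y - L x) * qbar (conv signed_Q P x y)"
    by (simp add: conv_def qbar_sum sum_distrib_left)
  also have "\<dots> = conv signed_Q P x y"
    using conv_signed_Q_P[OF assms(1) y] by (simp add: qbar_zero qbar_one q_zero)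
  finally show "conv signed_Q P x y = conv (conv ?A R) P x y" by simp
qed

text \<open>This is the bar of \<open>signed_Q_eq\<close>; the signs in \<open>signed_Q\<close> and
  in the dual relation cancel in pairs.\<close>

lemma qbar_Q:
  assumes "x \<in> E" "y \<in> E" "bruhat_le W S x y"
  shows "qbar (Q x y) = q (L x - L y) * conv Q R' x y"
proof -
  let ?e = "eps W S :: 'w \<Rightarrow> 'g zgr"
  have "qbar (Q x y) = (?e x * ?e x) * (?e y * ?e y) * qbar (Q x y)"
    by (simp add: eps_square)
  also have "\<dots> = ?e x * ?e y * qbar (signed_Q x y)"
    by (simp add: signed_Q_def qbar_mult qbar_eps algebra_simps)
  also have "qbar (signed_Q x y) = (\<Sum>t\<in>interval x y. q (L x - L t) * signed_Q x t * qbar (R t y))"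
    by (subst signed_Q_eq[OF assms]) (simp add: conv_def qbar_sum qbar_mult qbar_q qbar_qbar)
  also have "\<dots> = (\<Sum>t\<in>interval x y. ?e x * ?e y * q (L x - L y) * (Q x t * R' t y))"
  proof (rule sum.cong[OF HOL.refl])
    fix t assume "t \<in> interval x y"
    then have t: "t \<in> E" by (simp add: mem_interval)
    then have "qbar (R t y) = ?e t * ?e y * q (L t) * q (- L y) * R' t y"
      using R' assms unfolding is_dual_R_family_def by blast
    then have "q (L x - L t) * signed_Q x t * qbar (R t y)
        = (?e t * ?e t) * (q (L x - L t) * (q (L t) * q (- L y))) * (?e x * ?e y * (Q x t * R' t y))"
      by (simp add: signed_Q_def algebra_simps)
    then show "q (L x - L t) * signed_Q x t * qbar (R t y) = ?e x * ?e y * q (L x - L y) * (Q x t * R' t y)"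
      by (simp add: eps_square q_mult_q algebra_simps)
  qed
  also have "?e x * ?e y * (\<Sum>t\<in>interval x y. ?e x * ?e y * q (L x - L y) * (Q x t * R' t y))
      = (?e x * ?e x) * (?e y * ?e y) * (q (L x - L y) * conv Q R' x y)"
    by (simp add: conv_def sum_distrib_left algebra_simps)
  finally show ?thesis by (simp add: eps_square)
qed

lemma lookup_Q_conv:
  assumes "x \<in> E" "y \<in> E" "bruhat_le W S x y"
  shows "lookup (Q x y) \<gamma> = (\<Sum>t\<in>interval x y. lookup (Q x t * R' t y) (L y - L x - \<gamma>))"
proof -
  have "lookup (Q x y) \<gamma> = lookup (qbar (Q x y)) (- \<gamma>)"
    by (simp add: lookup_qbar)
  also have "\<dots> = lookup (conv Q R' x y) (L y - L x - \<gamma>)"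
    by (simp add: qbar_Q[OF assms] lookup_q_times algebra_simps)
  finally show ?thesis by (simp add: conv_def lookup_sum)
qed

text \<open>Off the diagonal, \<open>conv signed_Q P\<close> vanishes, so
  \<open>signed_Q x y\<close> is a combination of products with shorter \<open>t\<close>, and the
  bounds add up. Exponents are doubled because the group need not contain halves.\<close>

lemma signed_Q_degree:
  assumes x: "x \<in> E" and "y \<in> E" "bruhat_le W S x y" "x \<noteq> y" "lookup (signed_Q x y) e \<noteq> 0"
  shows "e + e < L y - L x"
  using assms(2-)
proof (induction "len y" arbitrary: y e rule: less_induct)
  case less
  note y = less.prems
  let ?I = "interval x y - {y}"
  have mem: "y \<in> interval x y" using y by (simp add: mem_interval bruhat_le_refl)
  have "signed_Q x y + (\<Sum>t\<in>?I. signed_Q x t * P t y) = 0"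
    using conv_signed_Q_P[OF x y(1)] y P_props(1)[of y y]
    by (simp add: conv_def sum.remove[OF finite_interval mem])
  then have "signed_Q x y = - (\<Sum>t\<in>?I. signed_Q x t * P t y)"
    by (simp add: eq_neg_iff_add_eq_0)
  then have "(\<Sum>t\<in>?I. lookup (signed_Q x t * P t y) e) \<noteq> 0"
    using y(4) by (simp add: lookup_sum)
  then obtain t where t: "t \<in> ?I" "lookup (signed_Q x t * P t y) e \<noteq> 0"
    by (meson sum.neutral)
  then obtain a b where ab: "e = a + b" "lookup (signed_Q x t) a \<noteq> 0" "lookup (P t y) b \<noteq> 0"
    using keys_mult[of "signed_Q x t" "P t y"] by (auto simp: in_keys_iff[symmetric])
  have tE: "t \<in> E" "bruhat_le W S x t" "bruhat_le W S t y" "t \<noteq> y"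
    using t by (auto simp: mem_interval)
  \<comment> \<open>Only a weak bound, since \<open>t = x\<close> is possible; strictness comes from
    the factor \<open>P t y\<close> with \<open>t \<noteq> y\<close>.\<close>
  have "a + a \<le> L t - L x"
  proof (cases "t = x")
    case True
    then show ?thesis using ab(2) signed_Q_refl[OF x] by (auto simp: lookup_one when_def split: if_splits)
  next
    case False
    then show ?thesis
      using less.hyps[of t a] tE bruhat_le_cases[of t y] ab(2) by fastforce
  qed
  moreover have "b + b < L y - L t"
  proof -
    have "deg (P t y) + deg (P t y) < L y - L t"
      using P_props(2)[OF tE(1) y(1)] tE ab(3) by (auto simp: bruhat_less_def)
    moreover have "b \<le> deg (P t y)" using lookup_le_deg ab(3) by blast
    ultimately show ?thesis by (meson add_mono le_less_trans)
  qed
  ultimately have "(a + a) + (b + b) < (L t - L x) + (L y - L t)"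
    by (rule add_le_less_mono)
  then show ?case using ab(1) by (simp add: algebra_simps)
qed

lemma Q_degree:
  assumes "x \<in> E" "y \<in> E" "bruhat_le W S x y" "x \<noteq> y" "lookup (Q x y) e \<noteq> 0"
  shows "e + e < L y - L x"
  using signed_Q_degree[OF assms(1-4)] assms(5)
  by (simp add: signed_Q_def mult.assoc lookup_eps_times_eq_0_iff)

section \<open>One step of the recursion\<close>

text \<open>The exponent \<open>L y - L x - \<gamma>\<close> is shared between \<open>Q x t\<close>,
  at \<open>L t - L x - a\<close>, and \<open>R' t y\<close>, at the exponent seen here. In the
  theorem, \<open>L y - L x - \<gamma>\<close> and \<open>a\<close> become two consecutive entries
  of the index sequence.\<close>

definition link :: "'w \<Rightarrow> 'w \<Rightarrow> 'w \<Rightarrow> 'g \<Rightarrow> 'g \<Rightarrow> int"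
  where "link x t y \<gamma> a = lookup (R' t y) (L x - L t + (L y - L x - \<gamma>) + a)"

text \<open>The bound by \<open>\<gamma>\<close> reflects the exponents of \<open>R'\<close>, the
  last inequality the degree bound for \<open>Q x t\<close>. Requiring a nonzero \<open>link\<close>
  keeps the set finite.\<close>

definition link_set :: "'w \<Rightarrow> 'w \<Rightarrow> 'w \<Rightarrow> 'g \<Rightarrow> 'g set"
  where "link_set x t y \<gamma> = {a. link x t y \<gamma> a \<noteq> 0 \<and> a \<le> \<gamma> \<and> L t - L x - a < a}"

lemma finite_link: "finite {a. link x t y \<gamma> a \<noteq> 0}"
proof -
  let ?f = "\<lambda>a. L x - L t + (L y - L x - \<gamma>) + a"
  have "{a. link x t y \<gamma> a \<noteq> 0} = ?f -` Poly_Mapping.keys (R' t y)"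
    by (auto simp: link_def in_keys_iff)
  then show ?thesis by (simp add: finite_vimageI inj_on_def)
qed

lemma finite_link_set: "finite (link_set x t y \<gamma>)"
  unfolding link_set_def by (rule finite_subset[OF _ finite_link]) auto

lemma link_bounds:
  assumes "t \<in> E" "y \<in> E" "bruhat_le W S t y" "link x t y \<gamma> a \<noteq> 0" 
  shows "a \<le> \<gamma>" "\<gamma> \<in> weight_group S L \<Longrightarrow> a \<in> weight_group S L"
proof -
  let ?e = "L x - L t + (L y - L x - \<gamma>) + a"
  have e: "?e \<in> weight_group S L" "?e \<le> L y - L t"
    using R'_exponents[OF assms(1-3)] assms(4) by (auto simp: link_def)
  show "a \<le> \<gamma>" using e(2) by (simp add: algebra_simps)
  assume "\<gamma> \<in> weight_group S L"
  moreover have "L y - L t \<in> weight_group S L"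
    using assms E_carrier by (intro weight_group_diff weight_closed) auto
  ultimately have "(L y - L t) - \<gamma> \<in> weight_group S L"
    by (simp add: weight_group_diff)
  then have "?e - ((L y - L t) - \<gamma>) \<in> weight_group S L"
    using e(1) weight_group_diff by blast
  then show "a \<in> weight_group S L" by (simp add: algebra_simps)
qed

lemma link_set_weight:
  assumes "x \<in> E" "y \<in> E" "t \<in> interval x y" "\<gamma> \<in> weight_group S L" "a \<in> link_set x t y \<gamma>"
  shows "L t - L x - a \<in> weight_group S L"
proof (intro weight_group_diff)
  show "a \<in> weight_group S L"
    using assms link_bounds(2)[of t y x \<gamma> a] by (simp add: mem_interval link_set_def)
qed (use assms E_carrier in \<open>auto simp: mem_interval intro: weight_closed\<close>)

text \<open>The isolated \<open>R'\<close> coefficient is the contribution of \<open>t = x\<close>,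
  where \<open>Q x x = 1\<close>. The sum may still range over the whole interval.\<close>

lemma lookup_Q_rec:
  assumes x: "x \<in> E" and y: "y \<in> E" and xy: "bruhat_le W S x y"
  shows "lookup (Q x y) \<gamma> = lookup (R' x y) (L y - L x - \<gamma>) +
    (\<Sum>t\<in>interval x y. \<Sum>a\<in>link_set x t y \<gamma>. link x t y \<gamma> a * lookup (Q x t) (L t - L x - a))"
proof -
  let ?g = "\<lambda>t. \<Sum>a\<in>link_set x t y \<gamma>. link x t y \<gamma> a * lookup (Q x t) (L t - L x - a)"
  have mem: "x \<in> interval x y" using x xy by (simp add: mem_interval bruhat_le_refl)
  note remove = sum.remove[OF finite_interval[OF y] mem]
  \<comment> \<open>At \<open>t = x\<close> membership in \<open>link_set\<close> forces
    \<open>a \<noteq> 0\<close>, while \<open>Q x x = 1\<close> has only the exponent 0.\<close>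
  have gx: "?g x = 0"
  proof (rule sum.neutral, rule ballI)
    fix a assume "a \<in> link_set x x y \<gamma>"
    then have "a \<noteq> 0" by (auto simp: link_set_def)
    then show "link x x y \<gamma> a * lookup (Q x x) (L x - L x - a) = 0"
      using Q_refl[OF x] by (simp add: lookup_one)
  qed
  have "lookup (Q x t * R' t y) (L y - L x - \<gamma>) = ?g t" if "t \<in> interval x y - {x}" for t
  proof -
    have t: "t \<in> E" "bruhat_le W S x t" "bruhat_le W S t y" "x \<noteq> t"
      using that by (auto simp: mem_interval)
    let ?f = "\<lambda>a. L x - L t + (L y - L x - \<gamma>) + a"
    have "lookup (Q x t * R' t y) (L y - L x - \<gamma>) =
        (\<Sum>b\<in>?f ` link_set x t y \<gamma>. lookup (Q x t) (L y - L x - \<gamma> - b) * lookup (R' t y) b)"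
    proof (rule lookup_times)
      show "finite (?f ` link_set x t y \<gamma>)" using finite_link_set by blast
      fix b
      assume b: "lookup (Q x t) (L y - L x - \<gamma> - b) \<noteq> 0" "lookup (R' t y) b \<noteq> 0"
      define a where "a = b - (L x - L t + (L y - L x - \<gamma>))"
      have bf: "b = ?f a" by (simp add: a_def)
      have "lookup (Q x t) (L t - L x - a) \<noteq> 0"
        using b(1) by (simp add: a_def algebra_simps)
      then have "(L t - L x - a) + (L t - L x - a) < L t - L x"
        by (rule Q_degree[OF x t(1,2,4)])
      then have "L t - L x - a < a" by (simp add: algebra_simps)
      moreover have "link x t y \<gamma> a \<noteq> 0" using b(2) bf by (simp add: link_def)
      ultimately have "a \<in> link_set x t y \<gamma>"
        using link_bounds(1)[OF t(1) y t(3)] by (simp add: link_set_def)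
      then show "b \<in> ?f ` link_set x t y \<gamma>" using bf by blast
    qed
    also have "\<dots> = ?g t"
      by (subst sum.reindex) (auto simp: inj_on_def link_def algebra_simps intro!: sum.cong)
    finally show ?thesis .
  qed
  then have "(\<Sum>t\<in>interval x y - {x}. lookup (Q x t * R' t y) (L y - L x - \<gamma>)) = (\<Sum>t\<in>interval x y - {x}. ?g t)"
    by (intro sum.cong) auto
  then show ?thesis
    unfolding lookup_Q_conv[OF assms] remove gx using Q_refl[OF x] by simp
qed

section \<open>Sums over multichains\<close>

text \<open>Membership is tested inside the summand, so that \<open>Sum_any\<close> can range over
  all lists. The factor with index 0 belongs to the top pair of the multichain.\<close>

definition chain_term :: "nat \<Rightarrow> 'w list \<Rightarrow> 'g \<Rightarrow> 'g list \<Rightarrow> int"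
  where "chain_term r \<phi> \<gamma> a = (if a \<in> index_set S L r \<gamma> \<phi>
    then \<Prod>i=0..r. lookup (R' (\<phi> ! (r - i)) (\<phi> ! (r + 1 - i)))
      (L (\<phi> ! 0) - L (\<phi> ! (r - i)) + a ! i + a ! (i + 1))
    else 0)"

definition chain_sum :: "nat \<Rightarrow> 'w \<Rightarrow> 'w \<Rightarrow> 'g \<Rightarrow> int"
  where "chain_sum r x y \<gamma> = (\<Sum>\<phi>\<in>multichains W S E r x y. Sum_any (chain_term r \<phi> \<gamma>))"

text \<open>Extending a multichain at its top prepends one entry to the index sequence. The tail is
  an index sequence for the next exponent
  \<open>L (\<phi> ! (r + 1)) - L (\<phi> ! 0) - b ! 0\<close>, whose prescribed head is
  \<open>b ! 0\<close> itself.\<close>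

lemma index_set_Suc:
  assumes len: "length \<phi> = r + 2" and a0: "L y - L (\<phi> ! 0) - \<gamma> \<in> weight_group S L"
  shows "a \<in> index_set S L (Suc r) \<gamma> (\<phi> @ [y]) \<longleftrightarrow>
    (\<exists>b. a = (L y - L (\<phi> ! 0) - \<gamma>) # b \<and> b ! 0 \<le> \<gamma> \<and>
      L (\<phi> ! (r + 1)) - L (\<phi> ! 0) - b ! 0 < b ! 0 \<and>
      b \<in> index_set S L r (L (\<phi> ! (r + 1)) - L (\<phi> ! 0) - b ! 0) \<phi>)"
    (is "?l \<longleftrightarrow> ?r")
proof -
  have ball: "(\<forall>i\<in>{1..Suc r}. C i) \<longleftrightarrow> C 1 \<and> (\<forall>i\<in>{1..r}. C (Suc i))" for C
  proof
    assume "C 1 \<and> (\<forall>i\<in>{1..r}. C (Suc i))"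
    then show "\<forall>i\<in>{1..Suc r}. C i"
      by (metis Suc_le_mono atLeastAtMost_iff le_SucE le_antisym not_less_eq_eq old.nat.exhaust
          One_nat_def le_zero_eq not_one_le_zero)
  qed auto
  let ?d = "L (\<phi> ! (r + 1)) - L (\<phi> ! 0)"
  show ?thesis
  proof (cases a)
    case Nil
    then show ?thesis by (simp add: index_set_def)
  next
    case (Cons c b)
    let ?tail = "\<lambda>b. b \<in> lists (weight_group S L) \<and> length b = r + 2 \<and> b ! 1 \<le> ?d - b ! 0 \<and>
        (\<forall>i\<in>{1..r}. b ! (i + 1) < b ! i) \<and> b ! (r + 1) = 0 \<and>
        (\<forall>i\<in>{1..r}. L (\<phi> ! (r + 1 - i)) - L (\<phi> ! 0) - b ! i < b ! i \<and>
          b ! (i + 1) \<le> L (\<phi> ! (r + 1 - i)) - L (\<phi> ! 0) - b ! i)"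
    have tail: "b \<in> index_set S L r (?d - b ! 0) \<phi> \<longleftrightarrow> ?tail b" for b
      by (simp add: index_set_def)
    have nth: "(\<phi> @ [y]) ! (Suc r + 1 - Suc i) = \<phi> ! (r + 1 - i)" for i
      using len by (simp add: nth_append less_Suc_eq_le le_diff_conv)
    have nth0: "(\<phi> @ [y]) ! 0 = \<phi> ! 0" "(\<phi> @ [y]) ! (Suc r + 1) = y"
      "(\<phi> @ [y]) ! (Suc r + 1 - 1) = \<phi> ! (r + 1)"
      using len by (simp_all add: nth_append)
    have "c # b \<in> index_set S L (Suc r) \<gamma> (\<phi> @ [y]) \<longleftrightarrow>
        c \<in> weight_group S L \<and> c = L y - L (\<phi> ! 0) - \<gamma> \<and> b ! 0 \<le> \<gamma> \<and> b ! 1 < b ! 0 \<and>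
        ?d - b ! 0 < b ! 0 \<and> ?tail b"
      unfolding index_set_def mem_Collect_eq ball nth nth0 by auto
    \<comment> \<open>The descent from \<open>b ! 0\<close> to \<open>b ! 1\<close> is recovered by
      transitivity through \<open>?d - b ! 0\<close>.\<close>
    also have "\<dots> \<longleftrightarrow> c = L y - L (\<phi> ! 0) - \<gamma> \<and> b ! 0 \<le> \<gamma> \<and> ?d - b ! 0 < b ! 0 \<and> ?tail b"
      using a0 le_less_trans[of "b ! 1" "?d - b ! 0" "b ! 0"] by blast
    finally show ?thesis
      unfolding Cons tail by (simp only: list.inject) blast
  qed
qed

lemma chain_term_Suc:
  assumes "length \<phi> = r + 2" and a0: "L y - L (\<phi> ! 0) - \<gamma> \<in> weight_group S L"
  shows "chain_term (Suc r) (\<phi> @ [y]) \<gamma> ((L y - L (\<phi> ! 0) - \<gamma>) # b) =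
    (if b ! 0 \<in> link_set (\<phi> ! 0) (\<phi> ! (r + 1)) y \<gamma>
     then link (\<phi> ! 0) (\<phi> ! (r + 1)) y \<gamma> (b ! 0) *
       chain_term r \<phi> (L (\<phi> ! (r + 1)) - L (\<phi> ! 0) - b ! 0) b
     else 0)"
proof -
  have nth: "(\<phi> @ [y]) ! (Suc r - i) = \<phi> ! (Suc r - i)" "(\<phi> @ [y]) ! (r - i) = \<phi> ! (r - i)" for i
    using assms(1) by (simp_all add: nth_append less_Suc_eq_le le_diff_conv)
  have nth0: "(\<phi> @ [y]) ! 0 = \<phi> ! 0" "(\<phi> @ [y]) ! Suc (Suc r) = y" "(\<phi> @ [y]) ! Suc r = \<phi> ! Suc r"
    using assms by (simp_all add: nth_append)
  show ?thesis
    unfolding chain_term_def index_set_Suc[OF assms] prod.atLeast0_atMost_Suc_shift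
    by (auto simp: nth nth0 link_set_def link_def)
qed

lemma chain_term_head:
  assumes "chain_term r \<phi> \<gamma> b \<noteq> 0"
  shows "b ! 0 = L (\<phi> ! (r + 1)) - L (\<phi> ! 0) - \<gamma>"
  using assms by (auto simp: chain_term_def index_set_def split: if_splits)

section \<open>Recursion for multichains and their sums\<close>

lemma multichains_props:
  assumes "\<phi> \<in> multichains W S E r x y"
  shows "length \<phi> = r + 2" "\<phi> ! 0 = x" "\<phi> ! (r + 1) = y" "set \<phi> \<subseteq> E"
  using assms by (auto simp: multichains_def)

lemma multichains_0:
  assumes "x \<in> E" "y \<in> E" "bruhat_le W S x y"
  shows "multichains W S E 0 x y = {[x, y]}"
  using assms by (auto simp: multichains_def length_Suc_conv numeral_2_eq_2)

lemma multichains_le: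
  assumes "\<phi> \<in> multichains W S E r x y"
  shows "bruhat_le W S x y"
proof -
  have "i \<le> r + 1 \<Longrightarrow> bruhat_le W S (\<phi> ! 0) (\<phi> ! i)" for i
  proof (induction i)
    case (Suc i)
    then have "bruhat_le W S (\<phi> ! i) (\<phi> ! (i + 1))"
      using assms by (simp add: multichains_def)
    then show ?case using Suc bruhat_le_trans by simp
  qed (simp add: bruhat_le_refl)
  from this[of "r + 1"] show ?thesis using multichains_props[OF assms] by simp
qed

text \<open>Chains grow at the upper end because the recursion for \<open>Q x y\<close> keeps
  \<open>x\<close> and replaces \<open>y\<close> by \<open>t\<close>.\<close>

lemma multichains_Suc:
  assumes "y \<in> E"
  shows "multichains W S E (Suc r) x y =
    (\<Union>t\<in>interval x y. (\<lambda>\<phi>. \<phi> @ [y]) ` multichains W S E r x t)"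
proof (intro equalityI subsetI)
  fix \<psi> assume \<psi>: "\<psi> \<in> multichains W S E (Suc r) x y"
  then have len: "length \<psi> = Suc (r + 2)" by (simp add: multichains_def)
  then obtain \<phi> z where z: "\<psi> = \<phi> @ [z]" "length \<phi> = r + 2"
    by (metis length_Suc_conv_rev)
  have zy: "z = y" using multichains_props(3)[OF \<psi>] z by (simp add: nth_append)
  have nth: "i \<le> r + 1 \<Longrightarrow> \<psi> ! i = \<phi> ! i" for i using z by (simp add: nth_append)
  have le: "i \<le> Suc r \<Longrightarrow> bruhat_le W S (\<psi> ! i) (\<psi> ! (i + 1))" for i
    using \<psi> by (simp add: multichains_def)
  let ?t = "\<phi> ! (r + 1)"
  have \<phi>: "\<phi> \<in> multichains W S E r x ?t"
    unfolding multichains_def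
  proof (intro CollectI conjI allI impI)
    show "\<phi> \<in> lists E" using multichains_props(4)[OF \<psi>] z by auto
    show "\<phi> ! 0 = x" using multichains_props(2)[OF \<psi>] nth[of 0] by simp
    show "bruhat_le W S (\<phi> ! i) (\<phi> ! (i + 1))" if "i \<le> r" for i
      using le[of i] nth[of i] nth[of "i + 1"] that by simp
  qed (use z in simp_all)
  moreover have "?t \<in> E"
    using nth_mem[of "r + 1" \<phi>] multichains_props(4)[OF \<phi>] z by auto
  then have "?t \<in> interval x y"
    using multichains_le[OF \<phi>] le[of "r + 1"] nth[of "r + 1"]
      multichains_props(3)[OF \<psi>] z by (simp add: mem_interval)
  ultimately show "\<psi> \<in> (\<Union>t\<in>interval x y. (\<lambda>\<phi>. \<phi> @ [y]) ` multichains W S E r x t)"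
    using z zy by blast
next
  fix \<psi> assume "\<psi> \<in> (\<Union>t\<in>interval x y. (\<lambda>\<phi>. \<phi> @ [y]) ` multichains W S E r x t)"
  then obtain t \<phi> where t: "t \<in> interval x y" "\<psi> = \<phi> @ [y]" "\<phi> \<in> multichains W S E r x t"
    by blast
  note props = multichains_props[OF t(3)]
  have "bruhat_le W S (\<psi> ! i) (\<psi> ! (i + 1))" if "i \<le> Suc r" for i
  proof (cases "i = Suc r")
    case True
    then show ?thesis using t props by (simp add: nth_append mem_interval)
  next
    case False
    then show ?thesis using that t props by (simp add: nth_append multichains_def)
  qed
  then show "\<psi> \<in> multichains W S E (Suc r) x y"
    using t props assms by (simp add: multichains_def nth_append)
qed

lemma finite_multichains: "x \<in> E \<Longrightarrow> y \<in> E \<Longrightarrow> finite (multichains W S E r x y)"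
proof (induction r arbitrary: y)
  case 0
  have "multichains W S E 0 x y \<subseteq> {[x, y]}"
    by (auto simp: multichains_def length_Suc_conv numeral_2_eq_2)
  then show ?case by (rule finite_subset) simp
next
  case (Suc r)
  then show ?case by (auto simp: multichains_Suc finite_interval mem_interval)
qed

lemma first_weight:
  assumes "x \<in> E" "y \<in> E" "\<gamma> \<in> weight_group S L"
  shows "L y - L x - \<gamma> \<in> weight_group S L"
  using assms E_carrier by (intro weight_group_diff weight_closed) auto

lemma chain_term_0:
  assumes x: "x \<in> E" and y: "y \<in> E" and xy: "bruhat_le W S x y" and \<gamma>: "\<gamma> \<in> weight_group S L"
  shows "chain_term 0 [x, y] \<gamma> a =
    (if a = [L y - L x - \<gamma>, 0] then lookup (R' x y) (L y - L x - \<gamma>) else 0)"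
proof -
  have "index_set S L 0 \<gamma> [x, y] = (if 0 \<le> \<gamma> then {[L y - L x - \<gamma>, 0]} else {})"
    using first_weight[OF x y \<gamma>] weight_group_zero
    by (auto simp: index_set_def length_Suc_conv numeral_2_eq_2)
  \<comment> \<open>For negative \<open>\<gamma>\<close> the index set is empty, which agrees with
    the bound on the exponents of \<open>R'\<close>.\<close>
  moreover have "lookup (R' x y) (L y - L x - \<gamma>) = 0" if "\<not> 0 \<le> \<gamma>"
    using R'_exponents(2)[OF x y xy, of "L y - L x - \<gamma>"] that by fastforce
  ultimately show ?thesis by (auto simp: chain_term_def)
qed

lemma chain_sum_0:
  assumes "x \<in> E" "y \<in> E" "bruhat_le W S x y" "\<gamma> \<in> weight_group S L"
  shows "chain_sum 0 x y \<gamma> = lookup (R' x y) (L y - L x - \<gamma>)"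
proof -
  have "chain_term 0 [x, y] \<gamma> = (\<lambda>a. lookup (R' x y) (L y - L x - \<gamma>) when a = [L y - L x - \<gamma>, 0])"
    using chain_term_0[OF assms] by (auto simp: when_def)
  then show ?thesis using multichains_0[OF assms(1-3)] by (simp add: chain_sum_def)
qed

lemma chain_term_support_Suc:
  assumes x: "x \<in> E" and y: "y \<in> E" and \<gamma>: "\<gamma> \<in> weight_group S L"
    and \<phi>: "\<phi> \<in> multichains W S E r x t"
  shows "{a. chain_term (Suc r) (\<phi> @ [y]) \<gamma> a \<noteq> 0} \<subseteq>
    (#) (L y - L x - \<gamma>) ` (\<Union>a\<in>link_set x t y \<gamma>. {b. chain_term r \<phi> (L t - L x - a) b \<noteq> 0})"
proof
  note props = multichains_props[OF \<phi>]
  note a0 = first_weight[OF x y \<gamma>]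
  fix a assume "a \<in> {a. chain_term (Suc r) (\<phi> @ [y]) \<gamma> a \<noteq> 0}"
  then have a: "chain_term (Suc r) (\<phi> @ [y]) \<gamma> a \<noteq> 0" by simp
  then have "a \<in> index_set S L (Suc r) \<gamma> (\<phi> @ [y])" by (simp add: chain_term_def split: if_splits)
  then obtain b where b: "a = (L y - L x - \<gamma>) # b"
    using index_set_Suc[of \<phi> r y \<gamma> a] props a0 by auto
  then show "a \<in> (#) (L y - L x - \<gamma>) ` (\<Union>a\<in>link_set x t y \<gamma>. {b. chain_term r \<phi> (L t - L x - a) b \<noteq> 0})"
    using a chain_term_Suc[of \<phi> r y \<gamma> b] props a0 by (auto split: if_splits)
qed

text \<open>\<open>Sum_any\<close> returns 0 on infinite support, so this is what makes the sums
  over index sets genuine: each extension of the chain multiplies the choices only by a finite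
  \<open>link_set\<close>.\<close>

lemma finite_chain_term:
  assumes "x \<in> E" "y \<in> E" "\<gamma> \<in> weight_group S L" "\<phi> \<in> multichains W S E r x y"
  shows "finite {a. chain_term r \<phi> \<gamma> a \<noteq> 0}"
  using assms
proof (induction r arbitrary: y \<gamma> \<phi>)
  case 0
  then have "\<phi> = [x, y]" "bruhat_le W S x y"
    using multichains_le[OF 0(4)] multichains_0 by auto
  then show ?case using 0 chain_term_0 by simp
next
  case (Suc r)
  obtain t \<phi>' where t: "t \<in> interval x y" "\<phi> = \<phi>' @ [y]" "\<phi>' \<in> multichains W S E r x t"
    using Suc.prems multichains_Suc by auto
  have "finite {b. chain_term r \<phi>' (L t - L x - a) b \<noteq> 0}" if "a \<in> link_set x t y \<gamma>" for a
    using Suc.IH[of t "L t - L x - a" \<phi>'] Suc.prems t link_set_weight[OF _ _ t(1) _ that]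
    by (simp add: mem_interval)
  then show ?case
    unfolding t(2)
    by (intro finite_subset[OF chain_term_support_Suc[OF Suc.prems(1-3) t(3)]])
      (simp add: finite_link_set)
qed

lemma Sum_any_chain_term_Suc:
  assumes x: "x \<in> E" and y: "y \<in> E" and \<gamma>: "\<gamma> \<in> weight_group S L"
    and t: "t \<in> interval x y" and \<phi>: "\<phi> \<in> multichains W S E r x t"
  shows "Sum_any (chain_term (Suc r) (\<phi> @ [y]) \<gamma>) =
    (\<Sum>a\<in>link_set x t y \<gamma>. link x t y \<gamma> a * Sum_any (chain_term r \<phi> (L t - L x - a)))"
proof -
  note props = multichains_props[OF \<phi>]
  let ?supp = "\<lambda>a. {b. chain_term r \<phi> (L t - L x - a) b \<noteq> 0}"
  let ?h = "(#) (L y - L x - \<gamma>)"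
  let ?K = "link_set x t y \<gamma>"
  have fin: "finite (?supp a)" if "a \<in> ?K" for a
    using finite_chain_term[OF x _ link_set_weight[OF x y t \<gamma> that] \<phi>] t by (simp add: mem_interval)
  \<comment> \<open>The entry \<open>a\<close> can be read off from \<open>b\<close>, so the
    supports for different \<open>a\<close> are disjoint.\<close>
  have head: "b ! 0 = a" if "b \<in> ?supp a" for a b
    using chain_term_head[of r \<phi> _ b] that props by fastforce
  have "Sum_any (chain_term (Suc r) (\<phi> @ [y]) \<gamma>) =
      (\<Sum>a\<in>?h ` (\<Union>a\<in>?K. ?supp a). chain_term (Suc r) (\<phi> @ [y]) \<gamma> a)"
    using fin finite_link_set
    by (intro Sum_any.expand_superset chain_term_support_Suc[OF x y \<gamma> \<phi>]) simp
  also have "\<dots> = (\<Sum>b\<in>(\<Union>a\<in>?K. ?supp a). chain_term (Suc r) (\<phi> @ [y]) \<gamma> (?h b))"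
    by (subst sum.reindex) auto
  also have "\<dots> = (\<Sum>a\<in>?K. \<Sum>b\<in>?supp a. chain_term (Suc r) (\<phi> @ [y]) \<gamma> (?h b))"
    using fin finite_link_set head by (intro sum.UNION_disjoint) blast+
  also have "\<dots> = (\<Sum>a\<in>?K. link x t y \<gamma> a * Sum_any (chain_term r \<phi> (L t - L x - a)))"
  proof (rule sum.cong[OF HOL.refl])
    fix a assume a: "a \<in> ?K"
    have "(\<Sum>b\<in>?supp a. chain_term (Suc r) (\<phi> @ [y]) \<gamma> (?h b)) =
        (\<Sum>b\<in>?supp a. link x t y \<gamma> a * chain_term r \<phi> (L t - L x - a) b)"
    proof (rule sum.cong[OF HOL.refl])
      fix b assume "b \<in> ?supp a"
      then show "chain_term (Suc r) (\<phi> @ [y]) \<gamma> (?h b) = link x t y \<gamma> a * chain_term r \<phi> (L t - L x - a) b"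
        using chain_term_Suc[of \<phi> r y \<gamma> b] props first_weight[OF x y \<gamma>] a head by simp
    qed
    then show "(\<Sum>b\<in>?supp a. chain_term (Suc r) (\<phi> @ [y]) \<gamma> (?h b)) =
        link x t y \<gamma> a * Sum_any (chain_term r \<phi> (L t - L x - a))"
      by (simp add: Sum_any.expand_set sum_distrib_left)
  qed
  finally show ?thesis .
qed

lemma chain_sum_Suc:
  assumes x: "x \<in> E" and y: "y \<in> E" and \<gamma>: "\<gamma> \<in> weight_group S L"
  shows "chain_sum (Suc r) x y \<gamma> =
    (\<Sum>t\<in>interval x y. \<Sum>a\<in>link_set x t y \<gamma>. link x t y \<gamma> a * chain_sum r x t (L t - L x - a))"
proof -
  let ?T = "\<lambda>\<phi>. Sum_any (chain_term (Suc r) \<phi> \<gamma>)"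
  let ?M = "multichains W S E r x"
  have "chain_sum (Suc r) x y \<gamma> = (\<Sum>t\<in>interval x y. \<Sum>\<phi>\<in>(\<lambda>\<phi>. \<phi> @ [y]) ` ?M t. ?T \<phi>)"
    unfolding chain_sum_def multichains_Suc[OF y]
  proof (rule sum.UNION_disjoint)
    show "\<forall>t\<in>interval x y. finite ((\<lambda>\<phi>. \<phi> @ [y]) ` ?M t)"
      using x finite_multichains by (simp add: mem_interval)
    show "\<forall>t\<in>interval x y. \<forall>u\<in>interval x y. t \<noteq> u \<longrightarrow>
        (\<lambda>\<phi>. \<phi> @ [y]) ` ?M t \<inter> (\<lambda>\<phi>. \<phi> @ [y]) ` ?M u = {}"
      by (auto dest: multichains_props(3))
  qed (rule finite_interval[OF y])
  also have "\<dots> = (\<Sum>t\<in>interval x y. \<Sum>\<phi>\<in>?M t. ?T (\<phi> @ [y]))"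
    by (rule sum.cong[OF HOL.refl], subst sum.reindex) (simp_all add: inj_on_def)
  also have "\<dots> = (\<Sum>t\<in>interval x y. \<Sum>\<phi>\<in>?M t. \<Sum>a\<in>link_set x t y \<gamma>.
      link x t y \<gamma> a * Sum_any (chain_term r \<phi> (L t - L x - a)))"
    using Sum_any_chain_term_Suc[OF x y \<gamma>] by (intro sum.cong HOL.refl) simp
  also have "\<dots> = (\<Sum>t\<in>interval x y. \<Sum>a\<in>link_set x t y \<gamma>. link x t y \<gamma> a * chain_sum r x t (L t - L x - a))"
    by (intro sum.cong HOL.refl, subst sum.swap) (simp add: chain_sum_def sum_distrib_left)
  finally show ?thesis .
qed

text \<open>Partial sums over the chain length obey the recursion \<open>lookup_Q_rec\<close>, with
  one fewer term on the right.\<close>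

lemma chain_sums_Suc:
  assumes x: "x \<in> E" and y: "y \<in> E" and xy: "bruhat_le W S x y" and \<gamma>: "\<gamma> \<in> weight_group S L"
  shows "(\<Sum>r<Suc n. chain_sum r x y \<gamma>) = lookup (R' x y) (L y - L x - \<gamma>) +
    (\<Sum>t\<in>interval x y. \<Sum>a\<in>link_set x t y \<gamma>. link x t y \<gamma> a * (\<Sum>r<n. chain_sum r x t (L t - L x - a)))"
proof -
  have "(\<Sum>r<n. chain_sum (Suc r) x y \<gamma>) = (\<Sum>t\<in>interval x y. \<Sum>r<n. \<Sum>a\<in>link_set x t y \<gamma>.
      link x t y \<gamma> a * chain_sum r x t (L t - L x - a))"
    unfolding chain_sum_Suc[OF x y \<gamma>] by (rule sum.swap)
  also have "\<dots> = (\<Sum>t\<in>interval x y. \<Sum>a\<in>link_set x t y \<gamma>. \<Sum>r<n.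
      link x t y \<gamma> a * chain_sum r x t (L t - L x - a))"
    by (intro sum.cong HOL.refl sum.swap)
  finally show ?thesis
    unfolding sum.lessThan_Suc_shift chain_sum_0[OF assms] by (simp add: sum_distrib_left)
qed

section \<open>Termination of the recursion\<close>

text \<open>For a low exponent the recursion never stays at \<open>y\<close>, so every step shortens
  the upper end, and the new exponent is low again by the definition of
  \<open>link_set\<close>.\<close>

lemma lookup_Q_low:
  assumes "x \<in> E" "y \<in> E" "bruhat_le W S x y" "\<gamma> \<in> weight_group S L"
    and "\<gamma> < L y - L x - \<gamma>" "len y \<le> len x + n"
  shows "lookup (Q x y) \<gamma> = (\<Sum>r<n. chain_sum r x y \<gamma>)"
  using assms
proof (induction n arbitrary: y \<gamma>)
  case 0
  \<comment> \<open>Here the hypothesis reads \<open>\<gamma> < - \<gamma>\<close>, so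
    \<open>\<gamma> \<noteq> 0\<close> and the coefficient of \<open>Q x x = 1\<close> vanishes like
    the empty sum.\<close>
  then have "x = y" using bruhat_le_cases[of x y] by simp
  then show ?case using 0 Q_refl[of x] by (auto simp: lookup_one when_def)
next
  case (Suc n)
  note prems = Suc.prems
  show ?case
    unfolding lookup_Q_rec[OF prems(1-3)] chain_sums_Suc[OF prems(1-4)]
  proof (intro arg_cong2[of _ _ _ _ "(+)"] HOL.refl sum.cong arg_cong2[of _ _ _ _ "(*)"])
    fix t a assume t: "t \<in> interval x y" and a: "a \<in> link_set x t y \<gamma>"
    have "t \<noteq> y"
    proof
      \<comment> \<open>This would give \<open>L y - L x < a + a\<close> with
        \<open>a \<le> \<gamma>\<close>, against the assumption that \<open>\<gamma>\<close> is
        low.\<close>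
      assume "t = y"
      with a have "L y - L x - a < a" "a \<le> \<gamma>" by (auto simp: link_set_def)
      then have "L y - L x < \<gamma> + \<gamma>" by (metis add_mono diff_less_eq less_le_trans)
      moreover have "\<gamma> + \<gamma> < L y - L x" using prems(5) by (simp only: less_diff_eq)
      ultimately show False by simp
    qed
    then have "len t \<le> len x + n"
      using t prems(6) bruhat_le_cases[of t y] by (auto simp: mem_interval)
    then show "lookup (Q x t) (L t - L x - a) = (\<Sum>r<n. chain_sum r x t (L t - L x - a))"
      using t a prems link_set_weight[OF prems(1,2) t prems(4) a]
      by (intro Suc.IH) (auto simp: mem_interval link_set_def)
  qed
qed

text \<open>For arbitrary \<open>\<gamma>\<close> the first unfolding may keep \<open>t = y\<close>,
  which costs one extra summand; after it all exponents are low.\<close>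

lemma lookup_Q:
  assumes x: "x \<in> E" and y: "y \<in> E" and xy: "bruhat_le W S x y" and \<gamma>: "\<gamma> \<in> weight_group S L"
  shows "lookup (Q x y) \<gamma> = (\<Sum>r<Suc (len y - len x). chain_sum r x y \<gamma>)"
  unfolding lookup_Q_rec[OF x y xy] chain_sums_Suc[OF assms]
proof (intro arg_cong2[of _ _ _ _ "(+)"] HOL.refl sum.cong arg_cong2[of _ _ _ _ "(*)"])
  fix t a assume t: "t \<in> interval x y" and a: "a \<in> link_set x t y \<gamma>"
  then have "len t \<le> len x + (len y - len x)"
    using bruhat_le_len[of t y] bruhat_le_len[OF xy] by (simp add: mem_interval)
  then show "lookup (Q x t) (L t - L x - a) = (\<Sum>r<len y - len x. chain_sum r x t (L t - L x - a))"
    using t a x link_set_weight[OF x y t \<gamma> a]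
    by (intro lookup_Q_low) (auto simp: mem_interval link_set_def)
qed

lemma chain_sum_eq:
  "chain_sum r x y \<gamma> = (\<Sum>\<phi>\<in>multichains W S E r x y. Sum_any (\<lambda>a. if a \<in> index_set S L r \<gamma> \<phi>
     then \<Prod>i=0..r. lookup (R' (\<phi> ! (r - i)) (\<phi> ! (r + 1 - i)))
       (L x - L (\<phi> ! (r - i)) + a ! i + a ! (i + 1))
     else 0))"
  unfolding chain_sum_def chain_term_def
  by (intro sum.cong HOL.refl) (simp add: multichains_props(2) cong: if_cong)

end

theorem theorem7p6:
  fixes W :: "('w, 'k) monoid_scheme" and S E J :: "'w set"
    and L :: "'w \<Rightarrow> 'g::linordered_ab_group_add"
    and hscale :: "('g \<Rightarrow>\<^sub>0 int) \<Rightarrow> 'h::ring_1 \<Rightarrow> 'h" and T :: "'w \<Rightarrow> 'h" and hbar :: "'h \<Rightarrow> 'h"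
    and mscale :: "('g \<Rightarrow>\<^sub>0 int) \<Rightarrow> 'm::ab_group_add \<Rightarrow> 'm"
    and act :: "'h \<Rightarrow> 'm \<Rightarrow> 'm" and B :: "'w \<Rightarrow> 'm" and mbar :: "'m \<Rightarrow> 'm"
    and R R' P Q :: "'w \<Rightarrow> 'w \<Rightarrow> ('g \<Rightarrow>\<^sub>0 int)"
    and x y :: 'w and \<gamma> :: 'g
  assumes ideal: "w_graph_ideal W S L hscale T hbar mscale E J act B mbar"
    and R: "is_R_family W S L mscale E B mbar R"
    and R_exponents: "R_exponents_bounded W S L E R"
    and R': "is_dual_R_family W S L E R R'"
    and P: "is_KL_family W S L E R P"
    and Q: "is_inverse_KL_family W S E P Q"
    and x: "x \<in> E" and y: "y \<in> E"
    and \<gamma>: "\<gamma> \<in> weight_group S L"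
  shows "Poly_Mapping.lookup (Q x y) \<gamma> =
      Poly_Mapping.lookup (eps W S x * eps W S y * R x y) \<gamma> +
      (\<Sum>r = 1..cox_length W S y - cox_length W S x.
        \<Sum>\<phi>\<in>multichains W S E r x y.
          Sum_any (\<lambda>a. if a \<in> index_set S L r \<gamma> \<phi>
            then \<Prod>i=0..r. Poly_Mapping.lookup (R' (\<phi> ! (r - i)) (\<phi> ! (r + 1 - i)))
                  (L x - L (\<phi> ! (r - i)) + a ! i + a ! (i + 1))
            else 0))"
proof -
  interpret I: w_graph_ideal W S L hscale T hbar mscale E J act B mbar by (rule ideal)
  interpret K: kl_setting W S L E R R' P Q
    by unfold_locales (use I.E_subset R_exponents R' P Q in auto)
  let ?n = "cox_length W S y - cox_length W S x"
  show ?thesis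
  proof (cases "bruhat_le W S x y")
    case True
    \<comment> \<open>The summand for \<open>r = 0\<close> is split off; by the reversal of
      coefficients in \<open>lookup_R'\<close> it is the signed \<open>R\<close> term.\<close>
    have "Poly_Mapping.lookup (Q x y) \<gamma> =
        K.chain_sum 0 x y \<gamma> + (\<Sum>r = 1..?n. K.chain_sum r x y \<gamma>)"
      unfolding K.lookup_Q[OF x y True \<gamma>] lessThan_Suc_atMost atMost_atLeast0
      by (simp add: sum.atLeast_Suc_atMost)
    moreover have "K.chain_sum 0 x y \<gamma> = Poly_Mapping.lookup (eps W S x * eps W S y * R x y) \<gamma>"
      unfolding K.chain_sum_0[OF x y True \<gamma>] K.lookup_R'[OF x y] by simp
    ultimately show ?thesis by (simp only: K.chain_sum_eq)
  next
    case False
    \<comment> \<open>For incomparable arguments everything vanishes, the \<open>R\<close> term by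
      triangularity of the bar involution.\<close>
    then have "multichains W S E r x y = {}" for r
      using K.multichains_le by blast
    then show ?thesis
      using K.Q_not_le[OF x y False] I.R_eq_0[OF R x y False] by simp
  qed
qed

end
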